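(* The copresheaf 2-monad $\mathbb{P}^{\dag}=(\mathsf{P}^{\dag},\mathsf{s}^{\dag},\mathsf{y}^{\dag})$ on $\mathcal{Q}\text{-}\mathbf{Cat}$ distributes strictly over the presheaf 2-monad $\mathbb{P}$ by $\lambda^{\dag}$ with $$\lambda^{\dag}_X=\overleftarrow{((\mathsf{y}_X)_{\text{!`}})_*}=((\mathsf{y}_X)_{\text{!`}})^!\cdot\mathsf{y}_{\mathsf{P}^{\dag}\mathsf{P}X}:\mathsf{P}^{\dag}\mathsf{P}X\to\mathsf{P}\mathsf{P}^{\dag}X ;$$ that is, the family $(\lambda^{\dag}_X)_X$, $X$ ranging over all $\mathcal{Q}$-categories, is a strict distributive law of $\mathbb{P}^{\dag}$ over $\mathbb{P}$.
   Context: Basic conventions. $\mathcal{Q}$ is a small quantaloid: a small category whose hom-sets are complete lattices (order $\preceq$) and whose composition preserves arbitrary suprema in each variable; $\mathcal{Q}_0$ is its object set. For $u:r\to s$, $v:s\to t$, $w:r\to t$ in $\mathcal{Q}$, the arrows $v\searrow w:r\to s$ and $w\swarrow u:s\to t$ are defined by $u\preceq v\searrow w\iff v\circ u\preceq w\iff v\preceq w\swarrow u$. For sets $X,Y$ equipped with type maps $|\text{-}|$ to $\mathcal{Q}_0$, a $\mathcal{Q}$-relation $\phi:X\nrightarrow Y$ assigns to each $(x,y)$ a morphism $\phi(x,y):|x|\to|y|$ of $\mathcal{Q}$; these are ordered pointwise by $\preceq$ and composed by $(\psi\circ\phi)(x,z)=\bigvee_y\psi(y,z)\circ\phi(x,y)$.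 A $\mathcal{Q}$-category is a set $X$ over $\mathcal{Q}_0$ with a $\mathcal{Q}$-relation $1_X^*:X\nrightarrow X$ (its hom) such that $1_{|x|}\preceq 1_X^*(x,x)$ and $1_X^*\circ 1_X^*\preceq 1_X^*$; it is preordered by $x\leq x'\iff |x|=|x'|$ and $1_{|x|}\preceq 1_X^*(x,x')$. A $\mathcal{Q}$-functor $f:X\to Y$ is a type-preserving map with $1_X^*(x,x')\preceq 1_Y^*(fx,fx')$; $f\leq g$ is pointwise. This gives the locally preordered 2-category $\mathcal{Q}\text{-}\mathbf{Cat}$. A 2-functor on it is a functor that is monotone on homs; a 2-monad $(T,m,e)$ is a monad whose functor $T$ is a 2-functor (multiplication $m:TT\to T$, unit $e:1\to T$). A distributor $\phi:X\nrightarrow Y$ is a $\mathcal{Q}$-relation with $1_Y^*\circ\phi\circ 1_X^*\preceq\phi$. For a $\mathcal{Q}$-functor $f:X\to Y$: $f_*:X\nrightarrow Y$, $f_*(x,y)=1_Y^*(fx,y)$, and $f^*:Y\nrightarrow X$, $f^*(y,x)=1_Y^*(y,fx)$. Let $\{s\}$ be the one-object $\mathcal{Q}$-category of type $s\in\mathcal{Q}_0$ with hom $1_s$. $\mathsf{P}X$ is the $\mathcal{Q}$-category of distributors $\sigma:X\nrightarrow\{s\}$ ($|\sigma|=s$) with $1_{\mathsf{P}X}^*(\sigma,\sigma')=\bigwedge_x\sigma'(x)\swarrow\sigma(x)$; $\mathsf{P}^{\dag}X$ is the $\mathcal{Q}$-category of distributors $\tau:\{s\}\nrightarrow X$ ($|\tau|=s$)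 with $1_{\mathsf{P}^{\dag}X}^*(\tau,\tau')=\bigwedge_x\tau'(x)\searrow\tau(x)$ (so $\tau\leq\tau'$ in $\mathsf{P}^{\dag}X$ iff $\tau'\preceq\tau$). Yoneda embeddings: $\mathsf{y}_X:X\to\mathsf{P}X$, $x\mapsto 1_X^*(-,x)$; $\mathsf{y}^{\dag}_X:X\to\mathsf{P}^{\dag}X$, $x\mapsto 1_X^*(x,-)$. For $f:X\to Y$: $f_!:\mathsf{P}X\to\mathsf{P}Y$, $\sigma\mapsto\sigma\circ f^*$; $f^!:\mathsf{P}Y\to\mathsf{P}X$, $\sigma\mapsto\sigma\circ f_*$; $f_{\text{!`}}:\mathsf{P}^{\dag}X\to\mathsf{P}^{\dag}Y$, $\tau\mapsto f_*\circ\tau$; $f^{\text{!`}}:\mathsf{P}^{\dag}Y\to\mathsf{P}^{\dag}X$, $\tau\mapsto f^*\circ\tau$. For a distributor $\phi:X\nrightarrow Y$, $\overleftarrow{\phi}:Y\to\mathsf{P}X$ is $y\mapsto\phi(-,y)$. The presheaf 2-monad $\mathbb{P}=(\mathsf{P},\mathsf{s},\mathsf{y})$ sends $f$ to $f_!$, with unit $\mathsf{y}$ and multiplication $\mathsf{s}_X=\mathsf{y}_X^!:\mathsf{P}\mathsf{P}X\to\mathsf{P}X$. The copresheaf 2-monad $\mathbb{P}^{\dag}=(\mathsf{P}^{\dag},\mathsf{s}^{\dag},\mathsf{y}^{\dag})$ sends $f$ to $f_{\text{!`}}$, with unit $\mathsf{y}^{\dag}$ and multiplication $\mathsf{s}^{\dag}_X=(\mathsf{y}^{\dag}_X)^{\text{!`}}:\mathsf{P}^{\dag}\mathsf{P}^{\dag}X\to\mathsf{P}^{\dag}X$.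 Distributive laws ("distributive law" means lax distributive law). For a 2-monad $\mathbb{T}=(T,m,e)$ on $\mathcal{Q}\text{-}\mathbf{Cat}$, a distributive law $\lambda:T\mathsf{P}\to\mathsf{P}T$ of $\mathbb{T}$ over $\mathbb{P}$ is a family of $\mathcal{Q}$-functors $\lambda_X:T\mathsf{P}X\to\mathsf{P}TX$ such that for all $\mathcal{Q}$-functors $f:X\to Y$: (a) $(Tf)_!\cdot\lambda_X\leq\lambda_Y\cdot T(f_!)$; (b) $\mathsf{y}_{TX}\leq\lambda_X\cdot T\mathsf{y}_X$; (c) $\mathsf{s}_{TX}\cdot(\lambda_X)_!\cdot\lambda_{\mathsf{P}X}\leq\lambda_X\cdot T\mathsf{s}_X$; (d) $(e_X)_!\leq\lambda_X\cdot e_{\mathsf{P}X}$; (e) $(m_X)_!\cdot\lambda_{TX}\cdot T\lambda_X\leq\lambda_X\cdot m_{\mathsf{P}X}$. It is strict if (a)–(e) are equalities for all $X$ and $f$. "$\mathbb{T}$ distributes strictly over $\mathbb{P}$ by $\lambda$" means that $\lambda$ is a strict distributive law. *)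

theory Defs
  imports "HOL-Algebra.Complete_Lattice"
begin

section \<open>Small quantaloids\<close>

text \<open>
  \<open>Comp Q v u\<close> is the composite of \<open>u\<close> followed by \<open>v\<close>.  Since arrows carry their domain and
  codomain, distinct hom-sets are disjoint.  \<open>Le\<close> is only meaningful between parallel arrows.
\<close>

record ('o, 'm) quantaloid =
  Obj :: "'o set"
  Arr :: "'m set"
  Dom :: "'m \<Rightarrow> 'o"
  Cod :: "'m \<Rightarrow> 'o"
  Idn :: "'o \<Rightarrow> 'm"
  Comp :: "'m \<Rightarrow> 'm \<Rightarrow> 'm"
  Le :: "'m \<Rightarrow> 'm \<Rightarrow> bool"

definition Hom :: "('o, 'm) quantaloid \<Rightarrow> 'o \<Rightarrow> 'o \<Rightarrow> 'm set" where
  "Hom Q r s = {u \<in> Arr Q. Dom Q u = r \<and> Cod Q u = s}"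

definition hom_lat :: "('o, 'm) quantaloid \<Rightarrow> 'o \<Rightarrow> 'o \<Rightarrow> 'm gorder" where
  "hom_lat Q r s = \<lparr>carrier = Hom Q r s, eq = (=), le = Le Q\<rparr>"

locale quantaloid =
  fixes Q :: "('o, 'm) quantaloid"
  assumes Dom_Obj: "u \<in> Arr Q \<Longrightarrow> Dom Q u \<in> Obj Q"
    and Cod_Obj: "u \<in> Arr Q \<Longrightarrow> Cod Q u \<in> Obj Q"
    and Idn_Hom: "r \<in> Obj Q \<Longrightarrow> Idn Q r \<in> Hom Q r r"
    and Comp_Hom: "u \<in> Hom Q r s \<Longrightarrow> v \<in> Hom Q s t \<Longrightarrow> Comp Q v u \<in> Hom Q r t"
    and Comp_assoc: "u \<in> Hom Q p r \<Longrightarrow> v \<in> Hom Q r s \<Longrightarrow> w \<in> Hom Q s t \<Longrightarrow>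
      Comp Q w (Comp Q v u) = Comp Q (Comp Q w v) u"
    and Comp_Idn_right: "u \<in> Hom Q r s \<Longrightarrow> Comp Q u (Idn Q r) = u"
    and Comp_Idn_left: "u \<in> Hom Q r s \<Longrightarrow> Comp Q (Idn Q s) u = u"
    and complete_Hom: "r \<in> Obj Q \<Longrightarrow> s \<in> Obj Q \<Longrightarrow> complete_lattice (hom_lat Q r s)"
    and Comp_Sup_left: "u \<in> Hom Q r s \<Longrightarrow> t \<in> Obj Q \<Longrightarrow> A \<subseteq> Hom Q s t \<Longrightarrow>
      Comp Q (\<Squnion>\<^bsub>hom_lat Q s t\<^esub> A) u = \<Squnion>\<^bsub>hom_lat Q r t\<^esub> ((\<lambda>v. Comp Q v u) ` A)"
    and Comp_Sup_right: "v \<in> Hom Q s t \<Longrightarrow> r \<in> Obj Q \<Longrightarrow> A \<subseteq> Hom Q r s \<Longrightarrow>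
      Comp Q v (\<Squnion>\<^bsub>hom_lat Q r s\<^esub> A) = \<Squnion>\<^bsub>hom_lat Q r t\<^esub> ((\<lambda>u. Comp Q v u) ` A)"

text \<open>
  The residuals, for \<open>u : r \<rightarrow> s\<close>, \<open>v : s \<rightarrow> t\<close>, \<open>w : r \<rightarrow> t\<close>:
  \<open>resid_right Q v w : r \<rightarrow> s\<close> is \<open>v \<searrow> w\<close> and \<open>resid_left Q w u : s \<rightarrow> t\<close> is \<open>w \<swarrow> u\<close>.
\<close>

definition resid_right :: "('o, 'm) quantaloid \<Rightarrow> 'm \<Rightarrow> 'm \<Rightarrow> 'm" where
  "resid_right Q v w = (THE z. z \<in> Hom Q (Dom Q w) (Dom Q v) \<and>
     (\<forall>u \<in> Hom Q (Dom Q w) (Dom Q v). Le Q u z \<longleftrightarrow> Le Q (Comp Q v u) w))"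

definition resid_left :: "('o, 'm) quantaloid \<Rightarrow> 'm \<Rightarrow> 'm \<Rightarrow> 'm" where
  "resid_left Q w u = (THE z. z \<in> Hom Q (Cod Q u) (Cod Q w) \<and>
     (\<forall>v \<in> Hom Q (Cod Q u) (Cod Q w). Le Q v z \<longleftrightarrow> Le Q (Comp Q v u) w))"


section \<open>Relations, categories, functors and distributors over a quantaloid\<close>

text \<open>
  \<open>chom X x x'\<close> is \<open>1\<^sub>X\<^sup>*(x, x')\<close>.  Only \<open>carrier\<close> and \<open>ty\<close> matter where \<open>X\<close> merely serves as a
  typed set.
\<close>

record ('a, 'o, 'm) qcategory = "'a partial_object" +
  ty :: "'a \<Rightarrow> 'o"
  chom :: "'a \<Rightarrow> 'a \<Rightarrow> 'm"

text \<open>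
  Relations are functions on \<open>carrier X \<times> carrier Y\<close>, represented extensionally (undefined outside),
  so that equality in HOL is equality of relations.
\<close>

definition qrel ::
  "('o, 'm) quantaloid \<Rightarrow> ('a, 'o, 'm) qcategory \<Rightarrow> ('b, 'o, 'm) qcategory \<Rightarrow> ('a \<Rightarrow> 'b \<Rightarrow> 'm) set" where
  "qrel Q X Y = (\<Pi>\<^sub>E x \<in> carrier X. \<Pi>\<^sub>E y \<in> carrier Y. Hom Q (ty X x) (ty Y y))"

definition qrel_le ::
  "('o, 'm) quantaloid \<Rightarrow> ('a, 'o, 'm) qcategory \<Rightarrow> ('b, 'o, 'm) qcategory \<Rightarrow>
   ('a \<Rightarrow> 'b \<Rightarrow> 'm) \<Rightarrow> ('a \<Rightarrow> 'b \<Rightarrow> 'm) \<Rightarrow> bool" where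
  "qrel_le Q X Y \<phi> \<psi> \<longleftrightarrow> (\<forall>x \<in> carrier X. \<forall>y \<in> carrier Y. Le Q (\<phi> x y) (\<psi> x y))"

definition qrel_comp ::
  "('o, 'm) quantaloid \<Rightarrow> ('a, 'o, 'm) qcategory \<Rightarrow> ('b, 'o, 'm) qcategory \<Rightarrow> ('c, 'o, 'm) qcategory \<Rightarrow>
   ('b \<Rightarrow> 'c \<Rightarrow> 'm) \<Rightarrow> ('a \<Rightarrow> 'b \<Rightarrow> 'm) \<Rightarrow> ('a \<Rightarrow> 'c \<Rightarrow> 'm)" where
  "qrel_comp Q X Y Z \<psi> \<phi> = (\<lambda>x \<in> carrier X. \<lambda>z \<in> carrier Z.
     \<Squnion>\<^bsub>hom_lat Q (ty X x) (ty Z z)\<^esub> ((\<lambda>y. Comp Q (\<psi> y z) (\<phi> x y)) ` carrier Y))"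

definition qcategory :: "('o, 'm) quantaloid \<Rightarrow> ('a, 'o, 'm) qcategory \<Rightarrow> bool" where
  "qcategory Q X \<longleftrightarrow>
     ty X \<in> carrier X \<rightarrow> Obj Q \<and>
     chom X \<in> qrel Q X X \<and>
     (\<forall>x \<in> carrier X. Le Q (Idn Q (ty X x)) (chom X x x)) \<and>
     qrel_le Q X X (qrel_comp Q X X X (chom X) (chom X)) (chom X)"

definition qfunctor ::
  "('o, 'm) quantaloid \<Rightarrow> ('a, 'o, 'm) qcategory \<Rightarrow> ('b, 'o, 'm) qcategory \<Rightarrow> ('a \<Rightarrow> 'b) \<Rightarrow> bool" where
  "qfunctor Q X Y f \<longleftrightarrow>
     qcategory Q X \<and> qcategory Q Y \<and>
     f \<in> carrier X \<rightarrow> carrier Y \<and>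
     (\<forall>x \<in> carrier X. ty Y (f x) = ty X x) \<and>
     (\<forall>x \<in> carrier X. \<forall>x' \<in> carrier X. Le Q (chom X x x') (chom Y (f x) (f x')))"

definition distributor ::
  "('o, 'm) quantaloid \<Rightarrow> ('a, 'o, 'm) qcategory \<Rightarrow> ('b, 'o, 'm) qcategory \<Rightarrow> ('a \<Rightarrow> 'b \<Rightarrow> 'm) \<Rightarrow> bool" where
  "distributor Q X Y \<phi> \<longleftrightarrow>
     \<phi> \<in> qrel Q X Y \<and>
     qrel_le Q X Y (qrel_comp Q X Y Y (chom Y) (qrel_comp Q X X Y \<phi> (chom X))) \<phi>"

text \<open>The graph \<open>f\<^sub>*\<close> and cograph \<open>f\<^sup>*\<close> of a functor \<open>f : X \<rightarrow> Y\<close>.\<close>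

definition graph ::
  "('a, 'o, 'm) qcategory \<Rightarrow> ('b, 'o, 'm) qcategory \<Rightarrow> ('a \<Rightarrow> 'b) \<Rightarrow> ('a \<Rightarrow> 'b \<Rightarrow> 'm)" where
  "graph X Y f = (\<lambda>x \<in> carrier X. \<lambda>y \<in> carrier Y. chom Y (f x) y)"

definition cograph ::
  "('a, 'o, 'm) qcategory \<Rightarrow> ('b, 'o, 'm) qcategory \<Rightarrow> ('a \<Rightarrow> 'b) \<Rightarrow> ('b \<Rightarrow> 'a \<Rightarrow> 'm)" where
  "cograph X Y f = (\<lambda>y \<in> carrier Y. \<lambda>x \<in> carrier X. chom Y y (f x))"


section \<open>Presheaves and copresheaves\<close>

definition one_cat :: "('o, 'm) quantaloid \<Rightarrow> 'o \<Rightarrow> (unit, 'o, 'm) qcategory" where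
  "one_cat Q s = \<lparr>carrier = {()}, ty = (\<lambda>_. s), chom = (\<lambda>_ _. Idn Q s)\<rparr>"

text \<open>
  A presheaf is a pair \<open>(s, \<sigma>)\<close> of its type and a distributor from \<open>X\<close> to the one-object category
  of type \<open>s\<close>; dually for copresheaves.  The type has to be recorded because it cannot be
  recovered from \<open>\<sigma>\<close> when \<open>X\<close> is empty.
\<close>

type_synonym ('a, 'o, 'm) presheaf = "'o \<times> ('a \<Rightarrow> unit \<Rightarrow> 'm)"
type_synonym ('a, 'o, 'm) copresheaf = "'o \<times> (unit \<Rightarrow> 'a \<Rightarrow> 'm)"

definition psh_carrier ::
  "('o, 'm) quantaloid \<Rightarrow> ('a, 'o, 'm) qcategory \<Rightarrow> ('a, 'o, 'm) presheaf set" where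
  "psh_carrier Q X = {(s, \<sigma>). s \<in> Obj Q \<and> distributor Q X (one_cat Q s) \<sigma>}"

definition psh ::
  "('o, 'm) quantaloid \<Rightarrow> ('a, 'o, 'm) qcategory \<Rightarrow> (('a, 'o, 'm) presheaf, 'o, 'm) qcategory" where
  "psh Q X = \<lparr>carrier = psh_carrier Q X, ty = fst,
     chom = (\<lambda>\<sigma> \<in> psh_carrier Q X. \<lambda>\<sigma>' \<in> psh_carrier Q X.
       \<Sqinter>\<^bsub>hom_lat Q (fst \<sigma>) (fst \<sigma>')\<^esub> ((\<lambda>x. resid_left Q (snd \<sigma>' x ()) (snd \<sigma> x ())) ` carrier X))\<rparr>"

definition copsh_carrier ::
  "('o, 'm) quantaloid \<Rightarrow> ('a, 'o, 'm) qcategory \<Rightarrow> ('a, 'o, 'm) copresheaf set" where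
  "copsh_carrier Q X = {(s, \<tau>). s \<in> Obj Q \<and> distributor Q (one_cat Q s) X \<tau>}"

definition copsh ::
  "('o, 'm) quantaloid \<Rightarrow> ('a, 'o, 'm) qcategory \<Rightarrow> (('a, 'o, 'm) copresheaf, 'o, 'm) qcategory" where
  "copsh Q X = \<lparr>carrier = copsh_carrier Q X, ty = fst,
     chom = (\<lambda>\<tau> \<in> copsh_carrier Q X. \<lambda>\<tau>' \<in> copsh_carrier Q X.
       \<Sqinter>\<^bsub>hom_lat Q (fst \<tau>) (fst \<tau>')\<^esub> ((\<lambda>x. resid_right Q (snd \<tau>' () x) (snd \<tau> () x)) ` carrier X))\<rparr>"

definition yoneda :: "('a, 'o, 'm) qcategory \<Rightarrow> 'a \<Rightarrow> ('a, 'o, 'm) presheaf" where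
  "yoneda X x = (ty X x, \<lambda>x' \<in> carrier X. \<lambda>_. chom X x' x)"

definition coyoneda :: "('a, 'o, 'm) qcategory \<Rightarrow> 'a \<Rightarrow> ('a, 'o, 'm) copresheaf" where
  "coyoneda X x = (ty X x, \<lambda>_. \<lambda>x' \<in> carrier X. chom X x x')"

text \<open>
  For \<open>f : X \<rightarrow> Y\<close>: \<open>psh_image\<close> and \<open>psh_preimage\<close> are \<open>f\<^sub>! : P X \<rightarrow> P Y\<close> and
  \<open>f\<^sup>! : P Y \<rightarrow> P X\<close>; \<open>copsh_image\<close> and \<open>copsh_preimage\<close> are the corresponding functors between
  the copresheaf categories (written with an inverted exclamation mark).
\<close>

definition psh_image ::
  "('o, 'm) quantaloid \<Rightarrow> ('a, 'o, 'm) qcategory \<Rightarrow> ('b, 'o, 'm) qcategory \<Rightarrow> ('a \<Rightarrow> 'b) \<Rightarrow>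
   ('a, 'o, 'm) presheaf \<Rightarrow> ('b, 'o, 'm) presheaf" where
  "psh_image Q X Y f \<sigma> =
     (fst \<sigma>, qrel_comp Q Y X (one_cat Q (fst \<sigma>)) (snd \<sigma>) (cograph X Y f))"

definition psh_preimage ::
  "('o, 'm) quantaloid \<Rightarrow> ('a, 'o, 'm) qcategory \<Rightarrow> ('b, 'o, 'm) qcategory \<Rightarrow> ('a \<Rightarrow> 'b) \<Rightarrow>
   ('b, 'o, 'm) presheaf \<Rightarrow> ('a, 'o, 'm) presheaf" where
  "psh_preimage Q X Y f \<sigma> =
     (fst \<sigma>, qrel_comp Q X Y (one_cat Q (fst \<sigma>)) (snd \<sigma>) (graph X Y f))"

definition copsh_image ::
  "('o, 'm) quantaloid \<Rightarrow> ('a, 'o, 'm) qcategory \<Rightarrow> ('b, 'o, 'm) qcategory \<Rightarrow> ('a \<Rightarrow> 'b) \<Rightarrow>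
   ('a, 'o, 'm) copresheaf \<Rightarrow> ('b, 'o, 'm) copresheaf" where
  "copsh_image Q X Y f \<tau> =
     (fst \<tau>, qrel_comp Q (one_cat Q (fst \<tau>)) X Y (graph X Y f) (snd \<tau>))"

definition copsh_preimage ::
  "('o, 'm) quantaloid \<Rightarrow> ('a, 'o, 'm) qcategory \<Rightarrow> ('b, 'o, 'm) qcategory \<Rightarrow> ('a \<Rightarrow> 'b) \<Rightarrow>
   ('b, 'o, 'm) copresheaf \<Rightarrow> ('a, 'o, 'm) copresheaf" where
  "copsh_preimage Q X Y f \<tau> =
     (fst \<tau>, qrel_comp Q (one_cat Q (fst \<tau>)) Y X (cograph X Y f) (snd \<tau>))"

text \<open>The multiplications of the presheaf and the copresheaf 2-monad.\<close>

definition psh_mult ::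
  "('o, 'm) quantaloid \<Rightarrow> ('a, 'o, 'm) qcategory \<Rightarrow>
   (('a, 'o, 'm) presheaf, 'o, 'm) presheaf \<Rightarrow> ('a, 'o, 'm) presheaf" where
  "psh_mult Q X = psh_preimage Q X (psh Q X) (yoneda X)"

definition copsh_mult ::
  "('o, 'm) quantaloid \<Rightarrow> ('a, 'o, 'm) qcategory \<Rightarrow>
   (('a, 'o, 'm) copresheaf, 'o, 'm) copresheaf \<Rightarrow> ('a, 'o, 'm) copresheaf" where
  "copsh_mult Q X = copsh_preimage Q X (copsh Q X) (coyoneda X)"

text \<open>
  The map \<open>Y \<rightarrow> P X\<close>, \<open>y \<mapsto> \<phi>(-, y)\<close>, induced by a distributor \<open>\<phi>\<close> from \<open>X\<close> to \<open>Y\<close>.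
\<close>

definition transpose_psh ::
  "('a, 'o, 'm) qcategory \<Rightarrow> ('b, 'o, 'm) qcategory \<Rightarrow> ('a \<Rightarrow> 'b \<Rightarrow> 'm) \<Rightarrow>
   'b \<Rightarrow> ('a, 'o, 'm) presheaf" where
  "transpose_psh X Y \<phi> y = (ty Y y, \<lambda>x \<in> carrier X. \<lambda>_. \<phi> x y)"

definition lambda_dag ::
  "('o, 'm) quantaloid \<Rightarrow> ('a, 'o, 'm) qcategory \<Rightarrow>
   (('a, 'o, 'm) presheaf, 'o, 'm) copresheaf \<Rightarrow> (('a, 'o, 'm) copresheaf, 'o, 'm) presheaf" where
  "lambda_dag Q X =
     transpose_psh (copsh Q X) (copsh Q (psh Q X))
       (graph (copsh Q X) (copsh Q (psh Q X)) (copsh_image Q X (psh Q X) (yoneda X)))"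

end

theory Submission
  imports Defs
begin

text \<open>
  Write \<open>P\<close> and \<open>P'\<close> for the presheaf and the copresheaf construction and let
  \<open>h\<^sub>X : P' X \<rightarrow> P' (P X)\<close> be the copresheaf image of the Yoneda embedding.  Composing a copresheaf
  \<open>\<tau>\<close> with a presheaf \<open>\<sigma>\<close> gives one arrow \<open>\<sigma> \<circ> \<tau>\<close>, and \<open>h\<^sub>X \<tau>\<close> is the copresheaf
  \<open>\<sigma> \<mapsto> \<sigma> \<circ> \<tau>\<close> (\<open>copsh_yoneda_at\<close>).  By definition \<open>\<lambda>\<^sub>X \<Theta>\<close> is the presheaf
  \<open>\<tau> \<mapsto> P'(P X)(h\<^sub>X \<tau>, \<Theta>)\<close>.  In naturality and in the two multiplication laws, both sides are
  evaluated at a copresheaf \<open>\<tau>\<close> and brought into the form of a hom into the given element; the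
  law becomes an identity between the copresheaves in the first argument of that hom.

  Three facts, besides the two Yoneda lemmas, bring the sides into that form.

  \<^item> Restriction of copresheaves along \<open>f\<close> is left adjoint to their image along \<open>f\<close>
    (\<open>copsh_preimage_image_adjoint\<close>).  This moves an image from the second to the first argument
    of a hom.

  \<^item> The unit of the copresheaf monad at \<open>P' X\<close> is left adjoint to the multiplication at \<open>X\<close>
    (\<open>coyoneda_copsh_mult_adjoint\<close>), which does the same for the multiplication.

  \<^item> The presheaf image along a right adjoint is restriction along its left adjoint
    (\<open>psh_image_right_adjoint\<close>).  This removes the suprema on the left sides of the laws.

  The identities that remain concern \<open>h\<close>.  For naturality in \<open>f\<close> and for the multiplication
  of \<open>P\<close> they say that \<open>(\<sigma> \<circ> \<phi>) \<circ> \<tau> = \<sigma> \<circ> (\<phi> \<circ> \<tau>)\<close>, where \<open>\<phi>\<close> is the cograph of \<open>f\<close>,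
  respectively the graph of the Yoneda embedding.  The unit law of \<open>P\<close> says that \<open>h\<close> is fully
  faithful, the unit law of \<open>P'\<close> is the Yoneda lemma for copresheaves, and for the multiplication
  of \<open>P'\<close> one needs that \<open>h\<close> sends a representable copresheaf to evaluation at its
  representing object.
\<close>

section \<open>Order and residuals in the hom-lattices\<close>

context quantaloid
begin

abbreviation comp_syntax :: "'m \<Rightarrow> 'm \<Rightarrow> 'm" (infixl "\<cdot>" 70) where
  "v \<cdot> u \<equiv> Comp Q v u"

abbreviation le_syntax :: "'m \<Rightarrow> 'm \<Rightarrow> bool" (infix "\<preceq>" 50) where
  "u \<preceq> v \<equiv> Le Q u v"

lemma Hom_Obj: "u \<in> Hom Q r s \<Longrightarrow> r \<in> Obj Q" "u \<in> Hom Q r s \<Longrightarrow> s \<in> Obj Q"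
  using Dom_Obj Cod_Obj by (auto simp: Hom_def)

lemma hom_lat_simps [simp]:
  "carrier (hom_lat Q r s) = Hom Q r s" "le (hom_lat Q r s) = Le Q" "eq (hom_lat Q r s) = (=)"
  by (auto simp: hom_lat_def)

lemma Le_refl:
  assumes "u \<in> Hom Q r s"
  shows "u \<preceq> u"
proof -
  interpret complete_lattice "hom_lat Q r s"
    using assms Hom_Obj complete_Hom by blast
  show ?thesis using assms le_refl by simp
qed

lemma Le_antisym:
  assumes "u \<preceq> v" "v \<preceq> u" "u \<in> Hom Q r s" "v \<in> Hom Q r s"
  shows "u = v"
proof -
  interpret complete_lattice "hom_lat Q r s"
    using assms Hom_Obj complete_Hom by blast
  show ?thesis using assms le_antisym by simp
qed

lemma Le_trans:
  assumes "u \<preceq> v" "v \<preceq> w" "u \<in> Hom Q r s" "v \<in> Hom Q r s" "w \<in> Hom Q r s"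
  shows "u \<preceq> w"
proof -
  interpret complete_lattice "hom_lat Q r s"
    using assms Hom_Obj complete_Hom by blast
  show ?thesis using assms le_trans[of u v w] by simp
qed

lemma
  assumes "r \<in> Obj Q" "s \<in> Obj Q" "A \<subseteq> Hom Q r s"
  shows Sup_Hom: "\<Squnion>\<^bsub>hom_lat Q r s\<^esub> A \<in> Hom Q r s"
    and Inf_Hom: "\<Sqinter>\<^bsub>hom_lat Q r s\<^esub> A \<in> Hom Q r s"
    and Le_Sup: "u \<in> A \<Longrightarrow> u \<preceq> \<Squnion>\<^bsub>hom_lat Q r s\<^esub> A"
    and Sup_Le_iff: "w \<in> Hom Q r s \<Longrightarrow> \<Squnion>\<^bsub>hom_lat Q r s\<^esub> A \<preceq> w \<longleftrightarrow> (\<forall>u \<in> A. u \<preceq> w)"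
    and Le_Inf_iff: "w \<in> Hom Q r s \<Longrightarrow> w \<preceq> \<Sqinter>\<^bsub>hom_lat Q r s\<^esub> A \<longleftrightarrow> (\<forall>u \<in> A. w \<preceq> u)"
proof -
  interpret complete_lattice "hom_lat Q r s"
    using assms complete_Hom by blast
  show S: "\<Squnion>\<^bsub>hom_lat Q r s\<^esub> A \<in> Hom Q r s" and I: "\<Sqinter>\<^bsub>hom_lat Q r s\<^esub> A \<in> Hom Q r s"
    using sup_closed[of A] inf_closed[of A] assms by auto
  show U: "u \<preceq> \<Squnion>\<^bsub>hom_lat Q r s\<^esub> A" if "u \<in> A" for u
    using sup_upper[of A u] assms that by auto
  show "\<Squnion>\<^bsub>hom_lat Q r s\<^esub> A \<preceq> w \<longleftrightarrow> (\<forall>u \<in> A. u \<preceq> w)" if "w \<in> Hom Q r s"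
  proof
    assume "\<Squnion>\<^bsub>hom_lat Q r s\<^esub> A \<preceq> w"
    then show "\<forall>u \<in> A. u \<preceq> w" using Le_trans[OF U _ _ S that] assms(3) by blast
  qed (use sup_least[of A w] assms(3) that in simp)
  have L: "\<Sqinter>\<^bsub>hom_lat Q r s\<^esub> A \<preceq> u" if "u \<in> A" for u
    using inf_lower[of A u] assms that by auto
  show "w \<preceq> \<Sqinter>\<^bsub>hom_lat Q r s\<^esub> A \<longleftrightarrow> (\<forall>u \<in> A. w \<preceq> u)" if "w \<in> Hom Q r s"
  proof
    assume "w \<preceq> \<Sqinter>\<^bsub>hom_lat Q r s\<^esub> A"
    then show "\<forall>u \<in> A. w \<preceq> u" using Le_trans[OF _ L that I] assms(3) by blast
  qed (use inf_greatest[of A w] assms(3) that in simp)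
qed

lemma Sup_eq_greatest:
  assumes "A \<subseteq> Hom Q r s" "u \<in> A" "\<And>v. v \<in> A \<Longrightarrow> v \<preceq> u"
  shows "\<Squnion>\<^bsub>hom_lat Q r s\<^esub> A = u"
proof -
  have u: "u \<in> Hom Q r s" using assms by blast
  note sup = Hom_Obj[OF u] assms(1)
  show ?thesis
    using Le_antisym[OF _ Le_Sup[OF sup assms(2)] Sup_Hom[OF sup] u] Sup_Le_iff[OF sup u] assms(3)
    by blast
qed

lemma Hom_eqI:
  assumes "u \<in> Hom Q r s" "v \<in> Hom Q r s" "\<And>w. w \<in> Hom Q r s \<Longrightarrow> w \<preceq> u \<longleftrightarrow> w \<preceq> v"
  shows "u = v"
  using assms Le_antisym Le_refl by blast

text \<open>
  Monotonicity of composition is the case of a two-element supremum: if \<open>u \<preceq> u'\<close> then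
  \<open>u'\<close> is the join of \<open>{u, u'}\<close>.
\<close>

lemma Comp_mono_right:
  assumes "u \<preceq> u'" "u \<in> Hom Q r s" "u' \<in> Hom Q r s" "v \<in> Hom Q s t"
  shows "v \<cdot> u \<preceq> v \<cdot> u'"
proof -
  have "\<Squnion>\<^bsub>hom_lat Q r s\<^esub> {u, u'} = u'"
    using assms Le_refl by (intro Sup_eq_greatest) auto
  then have "v \<cdot> u' = \<Squnion>\<^bsub>hom_lat Q r t\<^esub> {v \<cdot> u, v \<cdot> u'}"
    using Comp_Sup_right[of v s t r "{u, u'}"] assms Hom_Obj by auto
  moreover have "v \<cdot> u \<preceq> \<Squnion>\<^bsub>hom_lat Q r t\<^esub> {v \<cdot> u, v \<cdot> u'}"
    using assms Comp_Hom Hom_Obj by (intro Le_Sup) auto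
  ultimately show ?thesis by simp
qed

lemma Comp_mono_left:
  assumes "v \<preceq> v'" "v \<in> Hom Q s t" "v' \<in> Hom Q s t" "u \<in> Hom Q r s"
  shows "v \<cdot> u \<preceq> v' \<cdot> u"
proof -
  have "\<Squnion>\<^bsub>hom_lat Q s t\<^esub> {v, v'} = v'"
    using assms Le_refl by (intro Sup_eq_greatest) auto
  then have "v' \<cdot> u = \<Squnion>\<^bsub>hom_lat Q r t\<^esub> {v \<cdot> u, v' \<cdot> u}"
    using Comp_Sup_left[of u r s t "{v, v'}"] assms Hom_Obj by auto
  moreover have "v \<cdot> u \<preceq> \<Squnion>\<^bsub>hom_lat Q r t\<^esub> {v \<cdot> u, v' \<cdot> u}"
    using assms Comp_Hom Hom_Obj by (intro Le_Sup) auto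
  ultimately show ?thesis by simp
qed

text \<open>
  The residual is the join of all arrows satisfying the defining inequality; it satisfies the
  inequality itself because composition preserves joins.
\<close>

lemma
  assumes v: "v \<in> Hom Q s t" and w: "w \<in> Hom Q r t"
  shows resid_right_Hom: "resid_right Q v w \<in> Hom Q r s"
    and Le_resid_right_iff: "u \<in> Hom Q r s \<Longrightarrow> u \<preceq> resid_right Q v w \<longleftrightarrow> v \<cdot> u \<preceq> w"
proof -
  let ?A = "{u \<in> Hom Q r s. v \<cdot> u \<preceq> w}"
  let ?z = "\<Squnion>\<^bsub>hom_lat Q r s\<^esub> ?A"
  have O: "r \<in> Obj Q" "s \<in> Obj Q" "t \<in> Obj Q" using v w Hom_Obj by auto
  have z: "?z \<in> Hom Q r s" using O by (intro Sup_Hom) auto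
  have "v \<cdot> ?z = \<Squnion>\<^bsub>hom_lat Q r t\<^esub> ((\<lambda>u. v \<cdot> u) ` ?A)"
    using v O by (intro Comp_Sup_right) auto
  also have "\<dots> \<preceq> w"
    using v w O Comp_Hom by (subst Sup_Le_iff) auto
  finally have vz: "v \<cdot> ?z \<preceq> w" .
  have iff: "u \<preceq> ?z \<longleftrightarrow> v \<cdot> u \<preceq> w" if u: "u \<in> Hom Q r s" for u
  proof
    assume "u \<preceq> ?z"
    then show "v \<cdot> u \<preceq> w"
      using Le_trans[OF Comp_mono_right[OF _ u z v] vz] u z v w Comp_Hom by blast
  qed (use u O in \<open>auto intro!: Le_Sup\<close>)
  have DC: "Dom Q w = r" "Dom Q v = s" using v w by (auto simp: Hom_def)
  have "resid_right Q v w = ?z"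
    unfolding resid_right_def DC
    by (rule the_equality) (use z iff in \<open>auto intro!: Hom_eqI[of _ r s]\<close>)
  with z iff show "resid_right Q v w \<in> Hom Q r s"
    and "u \<in> Hom Q r s \<Longrightarrow> u \<preceq> resid_right Q v w \<longleftrightarrow> v \<cdot> u \<preceq> w"
    by auto
qed

lemma
  assumes u: "u \<in> Hom Q r s" and w: "w \<in> Hom Q r t"
  shows resid_left_Hom: "resid_left Q w u \<in> Hom Q s t"
    and Le_resid_left_iff: "v \<in> Hom Q s t \<Longrightarrow> v \<preceq> resid_left Q w u \<longleftrightarrow> v \<cdot> u \<preceq> w"
proof -
  let ?A = "{v \<in> Hom Q s t. v \<cdot> u \<preceq> w}"
  let ?z = "\<Squnion>\<^bsub>hom_lat Q s t\<^esub> ?A"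
  have O: "r \<in> Obj Q" "s \<in> Obj Q" "t \<in> Obj Q" using u w Hom_Obj by auto
  have z: "?z \<in> Hom Q s t" using O by (intro Sup_Hom) auto
  have "?z \<cdot> u = \<Squnion>\<^bsub>hom_lat Q r t\<^esub> ((\<lambda>v. v \<cdot> u) ` ?A)"
    using u O by (intro Comp_Sup_left) auto
  also have "\<dots> \<preceq> w"
    using u w O Comp_Hom by (subst Sup_Le_iff) auto
  finally have zu: "?z \<cdot> u \<preceq> w" .
  have iff: "v \<preceq> ?z \<longleftrightarrow> v \<cdot> u \<preceq> w" if v: "v \<in> Hom Q s t" for v
  proof
    assume "v \<preceq> ?z"
    then show "v \<cdot> u \<preceq> w"
      using Le_trans[OF Comp_mono_left[OF _ v z u] zu] u z v w Comp_Hom by blast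
  qed (use v O in \<open>auto intro!: Le_Sup\<close>)
  have DC: "Cod Q u = s" "Cod Q w = t" using u w by (auto simp: Hom_def)
  have "resid_left Q w u = ?z"
    unfolding resid_left_def DC
    by (rule the_equality) (use z iff in \<open>auto intro!: Hom_eqI[of _ s t]\<close>)
  with z iff show "resid_left Q w u \<in> Hom Q s t"
    and "v \<in> Hom Q s t \<Longrightarrow> v \<preceq> resid_left Q w u \<longleftrightarrow> v \<cdot> u \<preceq> w"
    by auto
qed

lemma Hom_eqI_upper:
  assumes "u \<in> Hom Q r s" "v \<in> Hom Q r s" "\<And>w. w \<in> Hom Q r s \<Longrightarrow> u \<preceq> w \<longleftrightarrow> v \<preceq> w"
  shows "u = v"
  using assms Le_antisym Le_refl by blast

lemma Comp_Sup_Le_iff: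
  assumes "v \<in> Hom Q s t" "A \<subseteq> Hom Q r s" "w \<in> Hom Q r t"
  shows "v \<cdot> (\<Squnion>\<^bsub>hom_lat Q r s\<^esub> A) \<preceq> w \<longleftrightarrow> (\<forall>u \<in> A. v \<cdot> u \<preceq> w)"
  using assms Hom_Obj[OF assms(1)] Hom_Obj[OF assms(3)] Comp_Hom
  by (subst Comp_Sup_right, simp_all, subst Sup_Le_iff) auto

lemma Sup_Comp_Le_iff:
  assumes "u \<in> Hom Q r s" "A \<subseteq> Hom Q s t" "w \<in> Hom Q r t"
  shows "(\<Squnion>\<^bsub>hom_lat Q s t\<^esub> A) \<cdot> u \<preceq> w \<longleftrightarrow> (\<forall>v \<in> A. v \<cdot> u \<preceq> w)"
  using assms Hom_Obj[OF assms(1)] Hom_Obj[OF assms(3)] Comp_Hom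
  by (subst Comp_Sup_left, simp_all, subst Sup_Le_iff) auto


section \<open>Relations, categories and functors\<close>

lemma qrel_Hom:
  "\<phi> \<in> qrel Q X Y \<Longrightarrow> x \<in> carrier X \<Longrightarrow> y \<in> carrier Y \<Longrightarrow> \<phi> x y \<in> Hom Q (ty X x) (ty Y y)"
  by (auto simp: qrel_def PiE_iff)

lemma qrel_eqI:
  assumes "\<phi> \<in> qrel Q X Y" "\<psi> \<in> qrel Q X Y"
    "\<And>x y. x \<in> carrier X \<Longrightarrow> y \<in> carrier Y \<Longrightarrow> \<phi> x y = \<psi> x y"
  shows "\<phi> = \<psi>"
proof (rule PiE_ext[OF assms(1,2)[unfolded qrel_def]])
  fix x assume x: "x \<in> carrier X"
  show "\<phi> x = \<psi> x"
    using PiE_mem[OF assms(1)[unfolded qrel_def] x] PiE_mem[OF assms(2)[unfolded qrel_def] x]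
    by (rule PiE_ext) (simp add: assms(3) x)
qed

lemma
  assumes "\<phi> \<in> qrel Q X Y" "\<psi> \<in> qrel Q Y Z" "x \<in> carrier X" "z \<in> carrier Z"
    "ty X x \<in> Obj Q" "ty Z z \<in> Obj Q"
  shows qrel_comp_Hom: "qrel_comp Q X Y Z \<psi> \<phi> x z \<in> Hom Q (ty X x) (ty Z z)"
    and Le_qrel_comp: "y \<in> carrier Y \<Longrightarrow> \<psi> y z \<cdot> \<phi> x y \<preceq> qrel_comp Q X Y Z \<psi> \<phi> x z"
    and qrel_comp_Le_iff: "w \<in> Hom Q (ty X x) (ty Z z) \<Longrightarrow>
      qrel_comp Q X Y Z \<psi> \<phi> x z \<preceq> w \<longleftrightarrow> (\<forall>y \<in> carrier Y. \<psi> y z \<cdot> \<phi> x y \<preceq> w)"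
    and Comp_qrel_comp_Le_iff: "v \<in> Hom Q (ty Z z) t \<Longrightarrow> w \<in> Hom Q (ty X x) t \<Longrightarrow>
      v \<cdot> qrel_comp Q X Y Z \<psi> \<phi> x z \<preceq> w \<longleftrightarrow> (\<forall>y \<in> carrier Y. v \<cdot> (\<psi> y z \<cdot> \<phi> x y) \<preceq> w)"
    and qrel_comp_Comp_Le_iff: "u \<in> Hom Q r (ty X x) \<Longrightarrow> w \<in> Hom Q r (ty Z z) \<Longrightarrow>
      qrel_comp Q X Y Z \<psi> \<phi> x z \<cdot> u \<preceq> w \<longleftrightarrow> (\<forall>y \<in> carrier Y. (\<psi> y z \<cdot> \<phi> x y) \<cdot> u \<preceq> w)"
proof -
  let ?A = "(\<lambda>y. \<psi> y z \<cdot> \<phi> x y) ` carrier Y"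
  have A: "?A \<subseteq> Hom Q (ty X x) (ty Z z)"
    using Comp_Hom[OF qrel_Hom[OF assms(1,3)] qrel_Hom[OF assms(2) _ assms(4)]] by blast
  have eq: "qrel_comp Q X Y Z \<psi> \<phi> x z = \<Squnion>\<^bsub>hom_lat Q (ty X x) (ty Z z)\<^esub> ?A"
    using assms by (simp add: qrel_comp_def)
  note O = assms(5,6)
  show "qrel_comp Q X Y Z \<psi> \<phi> x z \<in> Hom Q (ty X x) (ty Z z)"
    and "y \<in> carrier Y \<Longrightarrow> \<psi> y z \<cdot> \<phi> x y \<preceq> qrel_comp Q X Y Z \<psi> \<phi> x z"
    and "w \<in> Hom Q (ty X x) (ty Z z) \<Longrightarrow>
      qrel_comp Q X Y Z \<psi> \<phi> x z \<preceq> w \<longleftrightarrow> (\<forall>y \<in> carrier Y. \<psi> y z \<cdot> \<phi> x y \<preceq> w)"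
    and "v \<in> Hom Q (ty Z z) t \<Longrightarrow> w \<in> Hom Q (ty X x) t \<Longrightarrow>
      v \<cdot> qrel_comp Q X Y Z \<psi> \<phi> x z \<preceq> w \<longleftrightarrow> (\<forall>y \<in> carrier Y. v \<cdot> (\<psi> y z \<cdot> \<phi> x y) \<preceq> w)"
    and "u \<in> Hom Q r (ty X x) \<Longrightarrow> w \<in> Hom Q r (ty Z z) \<Longrightarrow>
      qrel_comp Q X Y Z \<psi> \<phi> x z \<cdot> u \<preceq> w \<longleftrightarrow> (\<forall>y \<in> carrier Y. (\<psi> y z \<cdot> \<phi> x y) \<cdot> u \<preceq> w)"
    unfolding eq using A O
    by (simp_all add: Sup_Hom Le_Sup Sup_Le_iff Comp_Sup_Le_iff Sup_Comp_Le_iff)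
qed

lemma qrel_comp_eqI:
  assumes \<phi>: "\<phi> \<in> qrel Q X Y" and \<psi>: "\<psi> \<in> qrel Q Y Z" and x: "x \<in> carrier X" and z: "z \<in> carrier Z"
    and u: "u \<in> Hom Q (ty X x) (ty Z z)"
    and y: "y \<in> carrier Y" "u \<preceq> \<psi> y z \<cdot> \<phi> x y"
    and le: "\<And>y. y \<in> carrier Y \<Longrightarrow> \<psi> y z \<cdot> \<phi> x y \<preceq> u"
  shows "qrel_comp Q X Y Z \<psi> \<phi> x z = u"
proof (rule Le_antisym)
  note O = Hom_Obj[OF u]
  show H: "qrel_comp Q X Y Z \<psi> \<phi> x z \<in> Hom Q (ty X x) (ty Z z)"
    by (rule qrel_comp_Hom[OF \<phi> \<psi> x z O])
  show "qrel_comp Q X Y Z \<psi> \<phi> x z \<preceq> u"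
    using le by (simp add: qrel_comp_Le_iff[OF \<phi> \<psi> x z O u])
  show "u \<preceq> qrel_comp Q X Y Z \<psi> \<phi> x z"
    using Le_trans[OF y(2) Le_qrel_comp[OF \<phi> \<psi> x z O y(1)] u _ H]
      Comp_Hom[OF qrel_Hom[OF \<phi> x y(1)] qrel_Hom[OF \<psi> y(1) z]] .
qed (rule u)

lemma qrel_comp_qrel:
  assumes "\<phi> \<in> qrel Q X Y" "\<psi> \<in> qrel Q Y Z"
    "ty X \<in> carrier X \<rightarrow> Obj Q" "ty Z \<in> carrier Z \<rightarrow> Obj Q"
  shows "qrel_comp Q X Y Z \<psi> \<phi> \<in> qrel Q X Z"
proof -
  have "qrel_comp Q X Y Z \<psi> \<phi> x z \<in> Hom Q (ty X x) (ty Z z)"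
    if "x \<in> carrier X" "z \<in> carrier Z" for x z
    using qrel_comp_Hom[OF assms(1,2) that] assms(3,4) that by blast
  moreover have "qrel_comp Q X Y Z \<psi> \<phi> \<in> extensional (carrier X)"
    "\<And>x. x \<in> carrier X \<Longrightarrow> qrel_comp Q X Y Z \<psi> \<phi> x \<in> extensional (carrier Z)"
    by (simp_all add: qrel_comp_def)
  ultimately show ?thesis unfolding qrel_def PiE_iff by blast
qed

lemma qrel_comp_assoc:
  assumes \<phi>: "\<phi> \<in> qrel Q W X" and \<psi>: "\<psi> \<in> qrel Q X Y" and \<chi>: "\<chi> \<in> qrel Q Y Z"
    and ty: "ty W \<in> carrier W \<rightarrow> Obj Q" "ty X \<in> carrier X \<rightarrow> Obj Q"
      "ty Y \<in> carrier Y \<rightarrow> Obj Q" "ty Z \<in> carrier Z \<rightarrow> Obj Q"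
  shows "qrel_comp Q W Y Z \<chi> (qrel_comp Q W X Y \<psi> \<phi>) = qrel_comp Q W X Z (qrel_comp Q X Y Z \<chi> \<psi>) \<phi>"
proof (rule qrel_eqI)
  note \<psi>\<phi> = qrel_comp_qrel[OF \<phi> \<psi> ty(1,3)] and \<chi>\<psi> = qrel_comp_qrel[OF \<psi> \<chi> ty(2,4)]
  show l: "qrel_comp Q W Y Z \<chi> (qrel_comp Q W X Y \<psi> \<phi>) \<in> qrel Q W Z"
    by (rule qrel_comp_qrel[OF \<psi>\<phi> \<chi> ty(1,4)])
  show r: "qrel_comp Q W X Z (qrel_comp Q X Y Z \<chi> \<psi>) \<phi> \<in> qrel Q W Z"
    by (rule qrel_comp_qrel[OF \<phi> \<chi>\<psi> ty(1,4)])
  fix w z assume wz: "w \<in> carrier W" "z \<in> carrier Z"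
  then have O: "ty W w \<in> Obj Q" "ty Z z \<in> Obj Q" using ty by auto
  show "qrel_comp Q W Y Z \<chi> (qrel_comp Q W X Y \<psi> \<phi>) w z
      = qrel_comp Q W X Z (qrel_comp Q X Y Z \<chi> \<psi>) \<phi> w z"
  proof (rule Hom_eqI_upper[OF qrel_Hom[OF l wz] qrel_Hom[OF r wz]])
    fix u assume u: "u \<in> Hom Q (ty W w) (ty Z z)"
    have "qrel_comp Q W Y Z \<chi> (qrel_comp Q W X Y \<psi> \<phi>) w z \<preceq> u
        \<longleftrightarrow> (\<forall>y \<in> carrier Y. \<forall>x \<in> carrier X. \<chi> y z \<cdot> (\<psi> x y \<cdot> \<phi> w x) \<preceq> u)"
      using Comp_qrel_comp_Le_iff[OF \<phi> \<psi> wz(1) _ O(1) _ qrel_Hom[OF \<chi> _ wz(2)] u] ty(3)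
      by (auto simp: qrel_comp_Le_iff[OF \<psi>\<phi> \<chi> wz O u] Pi_iff)
    also have "\<dots> \<longleftrightarrow> (\<forall>x \<in> carrier X. \<forall>y \<in> carrier Y. (\<chi> y z \<cdot> \<psi> x y) \<cdot> \<phi> w x \<preceq> u)"
      using Comp_assoc[OF qrel_Hom[OF \<phi>] qrel_Hom[OF \<psi>] qrel_Hom[OF \<chi>]] wz by metis
    also have "\<dots> \<longleftrightarrow> qrel_comp Q W X Z (qrel_comp Q X Y Z \<chi> \<psi>) \<phi> w z \<preceq> u"
      using qrel_comp_Comp_Le_iff[OF \<psi> \<chi> _ wz(2) _ O(2) qrel_Hom[OF \<phi> wz(1)] u] ty(2)
      by (auto simp: qrel_comp_Le_iff[OF \<phi> \<chi>\<psi> wz O u] Pi_iff)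
    finally show "qrel_comp Q W Y Z \<chi> (qrel_comp Q W X Y \<psi> \<phi>) w z \<preceq> u
        \<longleftrightarrow> qrel_comp Q W X Z (qrel_comp Q X Y Z \<chi> \<psi>) \<phi> w z \<preceq> u" .
  qed
qed

lemma
  assumes "qcategory Q X"
  shows qcategory_ty: "ty X \<in> carrier X \<rightarrow> Obj Q"
    and qcategory_chom: "chom X \<in> qrel Q X X"
    and ty_Obj: "x \<in> carrier X \<Longrightarrow> ty X x \<in> Obj Q"
    and chom_Hom: "x \<in> carrier X \<Longrightarrow> x' \<in> carrier X \<Longrightarrow> chom X x x' \<in> Hom Q (ty X x) (ty X x')"
    and Idn_Le_chom: "x \<in> carrier X \<Longrightarrow> Idn Q (ty X x) \<preceq> chom X x x"
  using assms qrel_Hom[of "chom X" X X] by (auto simp: qcategory_def)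

lemma qcategory_iff:
  "qcategory Q X \<longleftrightarrow>
    ty X \<in> carrier X \<rightarrow> Obj Q \<and> chom X \<in> qrel Q X X \<and>
    (\<forall>x \<in> carrier X. Idn Q (ty X x) \<preceq> chom X x x) \<and>
    (\<forall>x \<in> carrier X. \<forall>y \<in> carrier X. \<forall>z \<in> carrier X. chom X y z \<cdot> chom X x y \<preceq> chom X x z)"
proof -
  have "qrel_le Q X X (qrel_comp Q X X X (chom X) (chom X)) (chom X) \<longleftrightarrow>
    (\<forall>x \<in> carrier X. \<forall>y \<in> carrier X. \<forall>z \<in> carrier X. chom X y z \<cdot> chom X x y \<preceq> chom X x z)"
    if "ty X \<in> carrier X \<rightarrow> Obj Q" "chom X \<in> qrel Q X X"
    using that by (auto simp: qrel_le_def qrel_comp_Le_iff qrel_Hom Pi_iff)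
  then show ?thesis unfolding qcategory_def by blast
qed

lemma chom_Comp_Le:
  "qcategory Q X \<Longrightarrow> x \<in> carrier X \<Longrightarrow> y \<in> carrier X \<Longrightarrow> z \<in> carrier X \<Longrightarrow>
    chom X y z \<cdot> chom X x y \<preceq> chom X x z"
  by (auto simp: qcategory_iff)

text \<open>
  These two inequalities supply the lower bounds in the Yoneda arguments: in a supremum or a
  universally quantified inequality over all objects, the instance at the representing object
  alone already suffices.
\<close>

lemma Le_Comp_chom:
  assumes "qcategory Q X" "x \<in> carrier X" "u \<in> Hom Q (ty X x) s"
  shows "u \<preceq> u \<cdot> chom X x x"
  using Comp_mono_right[OF Idn_Le_chom[OF assms(1,2)] Idn_Hom chom_Hom assms(3)]
    assms ty_Obj[OF assms(1,2)] Comp_Idn_right[OF assms(3)] by simp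

lemma Le_chom_Comp:
  assumes "qcategory Q X" "x \<in> carrier X" "u \<in> Hom Q s (ty X x)"
  shows "u \<preceq> chom X x x \<cdot> u"
  using Comp_mono_left[OF Idn_Le_chom[OF assms(1,2)] Idn_Hom chom_Hom assms(3)]
    assms ty_Obj[OF assms(1,2)] Comp_Idn_left[OF assms(3)] by simp

lemma
  assumes "qfunctor Q X Y f"
  shows qfunctor_dom: "qcategory Q X"
    and qfunctor_cod: "qcategory Q Y"
    and qfunctor_carrier: "x \<in> carrier X \<Longrightarrow> f x \<in> carrier Y"
    and qfunctor_ty: "x \<in> carrier X \<Longrightarrow> ty Y (f x) = ty X x"
    and qfunctor_chom: "x \<in> carrier X \<Longrightarrow> x' \<in> carrier X \<Longrightarrow> chom X x x' \<preceq> chom Y (f x) (f x')"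
  using assms by (auto simp: qfunctor_def)

lemma qfunctor_comp:
  assumes f: "qfunctor Q X Y f" and g: "qfunctor Q Y Z g"
  shows "qfunctor Q X Z (g \<circ> f)"
proof -
  have "chom X x x' \<preceq> chom Z (g (f x)) (g (f x'))" if "x \<in> carrier X" "x' \<in> carrier X" for x x'
    using Le_trans[OF qfunctor_chom[OF f that] qfunctor_chom[OF g]
        chom_Hom[OF qfunctor_dom[OF f] that]] that
      chom_Hom[OF qfunctor_dom[OF g], of "f x" "f x'"]
      chom_Hom[OF qfunctor_cod[OF g], of "g (f x)" "g (f x')"]
      qfunctor_carrier[OF f] qfunctor_carrier[OF g] qfunctor_ty[OF f] qfunctor_ty[OF g]
    by simp
  with f g show ?thesis by (auto simp: qfunctor_def Pi_iff)
qed

lemma qfunctor_cong: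
  assumes "qfunctor Q X Y f" "\<And>x. x \<in> carrier X \<Longrightarrow> g x = f x"
  shows "qfunctor Q X Y g"
  using assms by (auto simp: qfunctor_def)

lemma graph_qrel:
  assumes "qfunctor Q X Y f"
  shows "graph X Y f \<in> qrel Q X Y"
  using chom_Hom[OF qfunctor_cod[OF assms] qfunctor_carrier[OF assms]] qfunctor_ty[OF assms]
  by (auto simp: graph_def qrel_def)

lemma cograph_qrel:
  assumes "qfunctor Q X Y f"
  shows "cograph X Y f \<in> qrel Q Y X"
  using chom_Hom[OF qfunctor_cod[OF assms] _ qfunctor_carrier[OF assms]] qfunctor_ty[OF assms]
  by (auto simp: cograph_def qrel_def)

lemma one_cat_simps [simp]:
  "carrier (one_cat Q s) = {()}" "ty (one_cat Q s) i = s" "chom (one_cat Q s) i j = Idn Q s"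
  by (auto simp: one_cat_def)

text \<open>
  The one-object categories act trivially, so a distributor into or out of one of them is
  characterised by a single action inequality.
\<close>

lemma one_cat_chom_qrel: "s \<in> Obj Q \<Longrightarrow> chom (one_cat Q s) \<in> qrel Q (one_cat Q s) (one_cat Q s)"
  using Idn_Hom by (auto simp: qrel_def PiE_iff extensional_def)

lemma one_cat_comp_left:
  assumes "\<phi> \<in> qrel Q X (one_cat Q s)" "ty X \<in> carrier X \<rightarrow> Obj Q" "s \<in> Obj Q"
  shows "qrel_comp Q X (one_cat Q s) (one_cat Q s) (chom (one_cat Q s)) \<phi> = \<phi>"
proof (rule qrel_eqI)
  note 1 = one_cat_chom_qrel[OF assms(3)]
  show "qrel_comp Q X (one_cat Q s) (one_cat Q s) (chom (one_cat Q s)) \<phi> \<in> qrel Q X (one_cat Q s)"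
    using assms by (intro qrel_comp_qrel[OF _ 1]) auto
  fix x and i :: unit assume x: "x \<in> carrier X" "i \<in> carrier (one_cat Q s)"
  have H: "\<phi> x i \<in> Hom Q (ty X x) s" using qrel_Hom[OF assms(1) x] by simp
  then show "qrel_comp Q X (one_cat Q s) (one_cat Q s) (chom (one_cat Q s)) \<phi> x i = \<phi> x i"
    using Comp_Idn_left[OF H] Le_refl[OF H]
    by (intro qrel_comp_eqI[OF assms(1) 1 x, where y = "()"]) auto
qed (rule assms)

lemma one_cat_comp_right:
  assumes "\<phi> \<in> qrel Q (one_cat Q s) X" "ty X \<in> carrier X \<rightarrow> Obj Q" "s \<in> Obj Q"
  shows "qrel_comp Q (one_cat Q s) (one_cat Q s) X \<phi> (chom (one_cat Q s)) = \<phi>"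
proof (rule qrel_eqI)
  note 1 = one_cat_chom_qrel[OF assms(3)]
  show "qrel_comp Q (one_cat Q s) (one_cat Q s) X \<phi> (chom (one_cat Q s)) \<in> qrel Q (one_cat Q s) X"
    using assms by (intro qrel_comp_qrel[OF 1]) auto
  fix i :: unit and x assume x: "i \<in> carrier (one_cat Q s)" "x \<in> carrier X"
  have H: "\<phi> i x \<in> Hom Q s (ty X x)" using qrel_Hom[OF assms(1) x] by simp
  then show "qrel_comp Q (one_cat Q s) (one_cat Q s) X \<phi> (chom (one_cat Q s)) i x = \<phi> i x"
    using Comp_Idn_right[OF H] Le_refl[OF H]
    by (intro qrel_comp_eqI[OF 1 assms(1) x, where y = "()"]) auto
qed (rule assms)


section \<open>Presheaves\<close>

lemma ty_psh [simp]: "ty (psh Q X) = fst"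
  by (simp add: psh_def)

lemma mem_psh_iff:
  assumes X: "qcategory Q X"
  shows "\<sigma> \<in> carrier (psh Q X) \<longleftrightarrow>
    fst \<sigma> \<in> Obj Q \<and> snd \<sigma> \<in> qrel Q X (one_cat Q (fst \<sigma>)) \<and>
    (\<forall>x \<in> carrier X. \<forall>x' \<in> carrier X. snd \<sigma> x () \<cdot> chom X x' x \<preceq> snd \<sigma> x' ())"
proof -
  have "distributor Q X (one_cat Q s) \<phi> \<longleftrightarrow>
      (\<forall>x \<in> carrier X. \<forall>x' \<in> carrier X. \<phi> x () \<cdot> chom X x' x \<preceq> \<phi> x' ())"
    if s: "s \<in> Obj Q" and \<phi>: "\<phi> \<in> qrel Q X (one_cat Q s)" for s \<phi>
  proof -
    let ?\<psi> = "qrel_comp Q X X (one_cat Q s) \<phi> (chom X)"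
    have ty: "ty (one_cat Q s) \<in> carrier (one_cat Q s) \<rightarrow> Obj Q" using s by simp
    have "?\<psi> \<in> qrel Q X (one_cat Q s)"
      by (rule qrel_comp_qrel[OF qcategory_chom[OF X] \<phi> qcategory_ty[OF X] ty])
    then have "distributor Q X (one_cat Q s) \<phi> \<longleftrightarrow> (\<forall>x \<in> carrier X. ?\<psi> x () \<preceq> \<phi> x ())"
      using \<phi> one_cat_comp_left[OF _ qcategory_ty[OF X] s] by (simp add: distributor_def qrel_le_def)
    moreover have "?\<psi> x' () \<preceq> \<phi> x' () \<longleftrightarrow> (\<forall>x \<in> carrier X. \<phi> x () \<cdot> chom X x' x \<preceq> \<phi> x' ())"
      if "x' \<in> carrier X" for x'
      using qrel_comp_Le_iff[OF qcategory_chom[OF X] \<phi> that _ ty_Obj[OF X that]] qrel_Hom[OF \<phi> that] s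
      by simp
    ultimately show ?thesis by blast
  qed
  moreover have "distributor Q X (one_cat Q s) \<phi> \<Longrightarrow> \<phi> \<in> qrel Q X (one_cat Q s)" for s \<phi>
    by (simp add: distributor_def)
  ultimately show ?thesis
    by (cases \<sigma>) (auto simp: psh_def psh_carrier_def)
qed

lemma
  assumes "qcategory Q X" "\<sigma> \<in> carrier (psh Q X)"
  shows psh_Obj: "fst \<sigma> \<in> Obj Q"
    and psh_qrel: "snd \<sigma> \<in> qrel Q X (one_cat Q (fst \<sigma>))"
    and psh_Hom: "x \<in> carrier X \<Longrightarrow> snd \<sigma> x () \<in> Hom Q (ty X x) (fst \<sigma>)"
    and psh_Comp_chom_Le: "x \<in> carrier X \<Longrightarrow> x' \<in> carrier X \<Longrightarrow> snd \<sigma> x () \<cdot> chom X x' x \<preceq> snd \<sigma> x' ()"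
  using assms qrel_Hom[of "snd \<sigma>" X "one_cat Q (fst \<sigma>)" x "()"] by (auto simp: mem_psh_iff)

lemma psh_eqI:
  assumes "qcategory Q X" "\<sigma> \<in> carrier (psh Q X)" "\<sigma>' \<in> carrier (psh Q X)"
    "fst \<sigma> = fst \<sigma>'" "\<And>x. x \<in> carrier X \<Longrightarrow> snd \<sigma> x () = snd \<sigma>' x ()"
  shows "\<sigma> = \<sigma>'"
  using qrel_eqI[OF psh_qrel[OF assms(1,2)] psh_qrel[OF assms(1,3), folded assms(4)]] assms(4,5)
  by (auto simp: prod_eq_iff)

lemma restrict_mem_psh:
  assumes "qcategory Q X" "s \<in> Obj Q"
    "\<And>x. x \<in> carrier X \<Longrightarrow> g x \<in> Hom Q (ty X x) s"
    "\<And>x x'. x \<in> carrier X \<Longrightarrow> x' \<in> carrier X \<Longrightarrow> g x \<cdot> chom X x' x \<preceq> g x'"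
  shows "(s, \<lambda>x \<in> carrier X. \<lambda>_. g x) \<in> carrier (psh Q X)"
  using assms by (auto simp: mem_psh_iff qrel_def PiE_iff extensional_def)

lemma
  assumes X: "qcategory Q X" and \<sigma>: "\<sigma> \<in> carrier (psh Q X)" and \<sigma>': "\<sigma>' \<in> carrier (psh Q X)"
  shows psh_chom_Hom: "chom (psh Q X) \<sigma> \<sigma>' \<in> Hom Q (fst \<sigma>) (fst \<sigma>')"
    and Le_psh_chom_iff: "u \<in> Hom Q (fst \<sigma>) (fst \<sigma>') \<Longrightarrow>
      u \<preceq> chom (psh Q X) \<sigma> \<sigma>' \<longleftrightarrow> (\<forall>x \<in> carrier X. u \<cdot> snd \<sigma> x () \<preceq> snd \<sigma>' x ())"
proof -
  let ?A = "(\<lambda>x. resid_left Q (snd \<sigma>' x ()) (snd \<sigma> x ())) ` carrier X"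
  have eq: "chom (psh Q X) \<sigma> \<sigma>' = \<Sqinter>\<^bsub>hom_lat Q (fst \<sigma>) (fst \<sigma>')\<^esub> ?A"
    using \<sigma> \<sigma>' by (simp add: psh_def)
  have A: "?A \<subseteq> Hom Q (fst \<sigma>) (fst \<sigma>')"
    using resid_left_Hom[OF psh_Hom[OF X \<sigma>] psh_Hom[OF X \<sigma>']] by blast
  note inf = psh_Obj[OF X \<sigma>] psh_Obj[OF X \<sigma>'] A
  show "chom (psh Q X) \<sigma> \<sigma>' \<in> Hom Q (fst \<sigma>) (fst \<sigma>')"
    unfolding eq by (rule Inf_Hom[OF inf])
  show "u \<preceq> chom (psh Q X) \<sigma> \<sigma>' \<longleftrightarrow> (\<forall>x \<in> carrier X. u \<cdot> snd \<sigma> x () \<preceq> snd \<sigma>' x ())"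
    if "u \<in> Hom Q (fst \<sigma>) (fst \<sigma>')"
    unfolding eq Le_Inf_iff[OF inf that]
    using Le_resid_left_iff[OF psh_Hom[OF X \<sigma>] psh_Hom[OF X \<sigma>'] that] by simp
qed

lemma psh_chom_Comp_Le:
  assumes "qcategory Q X" "\<sigma> \<in> carrier (psh Q X)" "\<sigma>' \<in> carrier (psh Q X)" "x \<in> carrier X"
  shows "chom (psh Q X) \<sigma> \<sigma>' \<cdot> snd \<sigma> x () \<preceq> snd \<sigma>' x ()"
  using Le_psh_chom_iff[OF assms(1-3) psh_chom_Hom[OF assms(1-3)]]
    Le_refl[OF psh_chom_Hom[OF assms(1-3)]] assms(4) by blast

lemma qcategory_psh:
  assumes X: "qcategory Q X"
  shows "qcategory Q (psh Q X)"
  unfolding qcategory_iff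
proof (intro conjI ballI)
  show "ty (psh Q X) \<in> carrier (psh Q X) \<rightarrow> Obj Q" using psh_Obj[OF X] by auto
  have "chom (psh Q X) = (\<lambda>\<sigma> \<in> carrier (psh Q X). \<lambda>\<sigma>' \<in> carrier (psh Q X). chom (psh Q X) \<sigma> \<sigma>')"
    by (auto simp: psh_def fun_eq_iff)
  moreover have "\<dots> \<in> qrel Q (psh Q X) (psh Q X)"
    using psh_chom_Hom[OF X] by (simp add: qrel_def)
  ultimately show "chom (psh Q X) \<in> qrel Q (psh Q X) (psh Q X)" by simp
next
  fix \<sigma> assume \<sigma>: "\<sigma> \<in> carrier (psh Q X)"
  then show "Idn Q (ty (psh Q X) \<sigma>) \<preceq> chom (psh Q X) \<sigma> \<sigma>"
    using Le_psh_chom_iff[OF X \<sigma> \<sigma> Idn_Hom[OF psh_Obj[OF X \<sigma>]]] psh_Hom[OF X \<sigma>]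
      Comp_Idn_left[OF psh_Hom[OF X \<sigma>]] Le_refl[OF psh_Hom[OF X \<sigma>]] by simp
next
  fix \<rho> \<sigma> \<tau> assume \<rho>: "\<rho> \<in> carrier (psh Q X)" and \<sigma>: "\<sigma> \<in> carrier (psh Q X)"
    and \<tau>: "\<tau> \<in> carrier (psh Q X)"
  note u = psh_chom_Hom[OF X \<rho> \<sigma>] and v = psh_chom_Hom[OF X \<sigma> \<tau>]
  have "(chom (psh Q X) \<sigma> \<tau> \<cdot> chom (psh Q X) \<rho> \<sigma>) \<cdot> snd \<rho> x () \<preceq> snd \<tau> x ()"
    if x: "x \<in> carrier X" for x
  proof -
    note r = psh_Hom[OF X \<rho> x] and s = psh_Hom[OF X \<sigma> x] and t = psh_Hom[OF X \<tau> x]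
    show ?thesis
      unfolding Comp_assoc[OF r u v, symmetric]
      using Le_trans[OF Comp_mono_right[OF psh_chom_Comp_Le[OF X \<rho> \<sigma> x] Comp_Hom[OF r u] s v]
          psh_chom_Comp_Le[OF X \<sigma> \<tau> x] Comp_Hom[OF Comp_Hom[OF r u] v] Comp_Hom[OF s v] t] .
  qed
  then show "chom (psh Q X) \<sigma> \<tau> \<cdot> chom (psh Q X) \<rho> \<sigma> \<preceq> chom (psh Q X) \<rho> \<tau>"
    by (simp add: Le_psh_chom_iff[OF X \<rho> \<tau> Comp_Hom[OF u v]])
qed

lemma yoneda_mem_psh:
  assumes "qcategory Q X" "x \<in> carrier X"
  shows "yoneda X x \<in> carrier (psh Q X)"
  unfolding yoneda_def using assms
  by (intro restrict_mem_psh) (auto simp: ty_Obj chom_Hom chom_Comp_Le)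

lemma yoneda_simps [simp]:
  "fst (yoneda X x) = ty X x" "x' \<in> carrier X \<Longrightarrow> snd (yoneda X x) x' () = chom X x' x"
  by (auto simp: yoneda_def)

lemma yoneda_lemma:
  assumes X: "qcategory Q X" and x: "x \<in> carrier X" and \<sigma>: "\<sigma> \<in> carrier (psh Q X)"
  shows "chom (psh Q X) (yoneda X x) \<sigma> = snd \<sigma> x ()"
proof -
  note y = yoneda_mem_psh[OF X x] and s = psh_Hom[OF X \<sigma>]
  note H = psh_chom_Hom[OF X y \<sigma>, simplified]
  show ?thesis
  proof (rule Hom_eqI[OF H s[OF x]])
    fix u assume u: "u \<in> Hom Q (ty X x) (fst \<sigma>)"
    have "(\<forall>x' \<in> carrier X. u \<cdot> chom X x' x \<preceq> snd \<sigma> x' ()) \<longleftrightarrow> u \<preceq> snd \<sigma> x ()"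
    proof safe
      assume "\<forall>x' \<in> carrier X. u \<cdot> chom X x' x \<preceq> snd \<sigma> x' ()"
      then show "u \<preceq> snd \<sigma> x ()"
        using Le_trans[OF Le_Comp_chom[OF X x u] _ u Comp_Hom[OF chom_Hom[OF X x x] u] s[OF x]] x
        by blast
    next
      fix x' assume le: "u \<preceq> snd \<sigma> x ()" and x': "x' \<in> carrier X"
      note c = chom_Hom[OF X x' x]
      show "u \<cdot> chom X x' x \<preceq> snd \<sigma> x' ()"
        using Le_trans[OF Comp_mono_left[OF le u s[OF x] c] psh_Comp_chom_Le[OF X \<sigma> x x']
            Comp_Hom[OF c u] Comp_Hom[OF c s[OF x]] s[OF x']] .
    qed
    then show "u \<preceq> chom (psh Q X) (yoneda X x) \<sigma> \<longleftrightarrow> u \<preceq> snd \<sigma> x ()"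
      using Le_psh_chom_iff[OF X y \<sigma>] u by simp
  qed
qed

lemma qfunctor_yoneda:
  assumes X: "qcategory Q X"
  shows "qfunctor Q X (psh Q X) (yoneda X)"
  using assms qcategory_psh[OF X] yoneda_mem_psh[OF X] Le_refl[OF chom_Hom[OF X]]
  by (auto simp: qfunctor_def yoneda_lemma)

text \<open>The composite with the graph of \<open>f\<close> is a Yoneda supremum, attained at \<open>f x\<close>.\<close>

lemma
  assumes f: "qfunctor Q X Y f" and \<sigma>: "\<sigma> \<in> carrier (psh Q Y)"
  shows psh_preimage_mem: "psh_preimage Q X Y f \<sigma> \<in> carrier (psh Q X)"
    and psh_preimage_at: "x \<in> carrier X \<Longrightarrow> snd (psh_preimage Q X Y f \<sigma>) x () = snd \<sigma> (f x) ()"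
proof -
  note X = qfunctor_dom[OF f] and Y = qfunctor_cod[OF f] and fX = qfunctor_carrier[OF f]
    and fty = qfunctor_ty[OF f]
  note s = psh_Hom[OF Y \<sigma>] and sq = psh_qrel[OF Y \<sigma>] and O = psh_Obj[OF Y \<sigma>]
  have sf: "snd \<sigma> (f x) () \<in> Hom Q (ty X x) (fst \<sigma>)" if "x \<in> carrier X" for x
    using s[OF fX[OF that]] fty[OF that] by simp
  let ?\<sigma> = "psh_preimage Q X Y f \<sigma>"
  have at: "snd ?\<sigma> x () = snd \<sigma> (f x) ()" if x: "x \<in> carrier X" for x
    unfolding psh_preimage_def snd_conv
    using x fX[OF x] fty[OF x] sf[OF x] Le_Comp_chom[OF Y fX[OF x] s] psh_Comp_chom_Le[OF Y \<sigma> _ fX[OF x]]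
    by (intro qrel_comp_eqI[OF graph_qrel[OF f] sq x, where y = "f x"]) (auto simp: graph_def)
  have "snd ?\<sigma> \<in> qrel Q X (one_cat Q (fst \<sigma>))"
    unfolding psh_preimage_def snd_conv
    using O by (intro qrel_comp_qrel[OF graph_qrel[OF f] sq qcategory_ty[OF X]]) auto
  moreover have "snd \<sigma> (f x) () \<cdot> chom X x' x \<preceq> snd \<sigma> (f x') ()"
    if x: "x \<in> carrier X" and x': "x' \<in> carrier X" for x x'
  proof -
    note c = chom_Hom[OF X x' x]
    note c' = chom_Hom[OF Y fX[OF x'] fX[OF x], unfolded fty[OF x] fty[OF x']]
    show ?thesis
      using Le_trans[OF Comp_mono_right[OF qfunctor_chom[OF f x' x] c c' sf[OF x]]
          psh_Comp_chom_Le[OF Y \<sigma> fX[OF x] fX[OF x']]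
          Comp_Hom[OF c sf[OF x]] Comp_Hom[OF c' sf[OF x]] sf[OF x']] .
  qed
  ultimately show "?\<sigma> \<in> carrier (psh Q X)"
    unfolding mem_psh_iff[OF X] using O at by (simp add: psh_preimage_def)
  show "x \<in> carrier X \<Longrightarrow> snd ?\<sigma> x () = snd \<sigma> (f x) ()" by (rule at)
qed

lemma psh_preimage_ty [simp]: "fst (psh_preimage Q X Y f \<sigma>) = fst \<sigma>"
  by (simp add: psh_preimage_def)

lemma qfunctor_psh_preimage:
  assumes f: "qfunctor Q X Y f"
  shows "qfunctor Q (psh Q Y) (psh Q X) (psh_preimage Q X Y f)"
proof -
  note X = qfunctor_dom[OF f] and Y = qfunctor_cod[OF f] and fX = qfunctor_carrier[OF f]
  note mem = psh_preimage_mem[OF f]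
  have "chom (psh Q Y) \<sigma> \<sigma>' \<preceq> chom (psh Q X) (psh_preimage Q X Y f \<sigma>) (psh_preimage Q X Y f \<sigma>')"
    if \<sigma>: "\<sigma> \<in> carrier (psh Q Y)" "\<sigma>' \<in> carrier (psh Q Y)" for \<sigma> \<sigma>'
    using psh_chom_Comp_Le[OF Y \<sigma>] psh_chom_Hom[OF Y \<sigma>] fX psh_preimage_at[OF f] \<sigma>
    by (subst Le_psh_chom_iff[OF X mem mem]) auto
  then show ?thesis
    using mem qcategory_psh[OF X] qcategory_psh[OF Y] by (auto simp: qfunctor_def)
qed

lemma psh_image_ty [simp]: "fst (psh_image Q X Y f \<sigma>) = fst \<sigma>"
  by (simp add: psh_image_def)

lemma psh_image_mem:
  assumes f: "qfunctor Q X Y f" and \<sigma>: "\<sigma> \<in> carrier (psh Q X)"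
  shows "psh_image Q X Y f \<sigma> \<in> carrier (psh Q Y)"
proof -
  note X = qfunctor_dom[OF f] and Y = qfunctor_cod[OF f] and fX = qfunctor_carrier[OF f]
    and fty = qfunctor_ty[OF f]
  note s = psh_Hom[OF X \<sigma>] and sq = psh_qrel[OF X \<sigma>] and O = psh_Obj[OF X \<sigma>]
  note cg = cograph_qrel[OF f]
  let ?\<rho> = "qrel_comp Q Y X (one_cat Q (fst \<sigma>)) (snd \<sigma>) (cograph X Y f)"
  have \<rho>: "?\<rho> \<in> qrel Q Y (one_cat Q (fst \<sigma>))"
    using O by (intro qrel_comp_qrel[OF cg sq qcategory_ty[OF Y]]) auto
  have "?\<rho> y () \<cdot> chom Y y' y \<preceq> ?\<rho> y' ()" if y: "y \<in> carrier Y" and y': "y' \<in> carrier Y" for y y'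
  proof -
    note c = chom_Hom[OF Y y' y]
    have \<rho>': "?\<rho> y' () \<in> Hom Q (ty Y y') (fst \<sigma>)" using qrel_Hom[OF \<rho> y'] by simp
    have "(snd \<sigma> x () \<cdot> cograph X Y f y x) \<cdot> chom Y y' y \<preceq> ?\<rho> y' ()" if x: "x \<in> carrier X" for x
    proof -
      note d = chom_Hom[OF Y y fX[OF x], unfolded fty[OF x]]
        and d' = chom_Hom[OF Y y' fX[OF x], unfolded fty[OF x]]
      have "snd \<sigma> x () \<cdot> (chom Y y (f x) \<cdot> chom Y y' y) \<preceq> snd \<sigma> x () \<cdot> chom Y y' (f x)"
        by (rule Comp_mono_right[OF chom_Comp_Le[OF Y y' y fX[OF x]] Comp_Hom[OF c d] d' s[OF x]])
      moreover have "snd \<sigma> x () \<cdot> chom Y y' (f x) \<preceq> ?\<rho> y' ()"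
        using Le_qrel_comp[OF cg sq y' _ ty_Obj[OF Y y'] _ x, of "()"] O x y'
        by (simp add: cograph_def)
      ultimately show ?thesis
        using Le_trans[OF _ _ Comp_Hom[OF Comp_Hom[OF c d] s[OF x]] Comp_Hom[OF d' s[OF x]] \<rho>']
          Comp_assoc[OF c d s[OF x]] x y by (simp add: cograph_def)
    qed
    then show ?thesis
      using qrel_comp_Comp_Le_iff[OF cg sq y _ ty_Obj[OF Y y] _ c, of "()"] \<rho>' O by simp
  qed
  then show ?thesis
    unfolding mem_psh_iff[OF Y] using O \<rho> by (simp add: psh_image_def)
qed

lemma
  assumes f: "qfunctor Q X Y f" and \<sigma>: "\<sigma> \<in> carrier (psh Q X)" and y: "y \<in> carrier Y"
  shows Le_psh_image: "x \<in> carrier X \<Longrightarrow>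
      snd \<sigma> x () \<cdot> chom Y y (f x) \<preceq> snd (psh_image Q X Y f \<sigma>) y ()"
    and Comp_psh_image_Le_iff: "v \<in> Hom Q (fst \<sigma>) t \<Longrightarrow> w \<in> Hom Q (ty Y y) t \<Longrightarrow>
      v \<cdot> snd (psh_image Q X Y f \<sigma>) y () \<preceq> w
      \<longleftrightarrow> (\<forall>x \<in> carrier X. v \<cdot> (snd \<sigma> x () \<cdot> chom Y y (f x)) \<preceq> w)"
proof -
  note X = qfunctor_dom[OF f] and Y = qfunctor_cod[OF f]
  note sq = psh_qrel[OF X \<sigma>] and O = psh_Obj[OF X \<sigma>] and cg = cograph_qrel[OF f]
  show "snd \<sigma> x () \<cdot> chom Y y (f x) \<preceq> snd (psh_image Q X Y f \<sigma>) y ()" if x: "x \<in> carrier X"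
    using Le_qrel_comp[OF cg sq y _ ty_Obj[OF Y y] _ x, of "()"] O x y
    by (simp add: psh_image_def cograph_def)
  show "v \<cdot> snd (psh_image Q X Y f \<sigma>) y () \<preceq> w
      \<longleftrightarrow> (\<forall>x \<in> carrier X. v \<cdot> (snd \<sigma> x () \<cdot> chom Y y (f x)) \<preceq> w)"
    if "v \<in> Hom Q (fst \<sigma>) t" "w \<in> Hom Q (ty Y y) t"
    using Comp_qrel_comp_Le_iff[OF cg sq y _ ty_Obj[OF Y y], of "()" v t w] that O y
    by (simp add: psh_image_def cograph_def)
qed

lemma qfunctor_psh_image:
  assumes f: "qfunctor Q X Y f"
  shows "qfunctor Q (psh Q X) (psh Q Y) (psh_image Q X Y f)"
proof -
  note X = qfunctor_dom[OF f] and Y = qfunctor_cod[OF f] and fX = qfunctor_carrier[OF f]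
    and fty = qfunctor_ty[OF f]
  note mem = psh_image_mem[OF f]
  have "chom (psh Q X) \<sigma> \<sigma>' \<preceq> chom (psh Q Y) (psh_image Q X Y f \<sigma>) (psh_image Q X Y f \<sigma>')"
    if \<sigma>: "\<sigma> \<in> carrier (psh Q X)" and \<sigma>': "\<sigma>' \<in> carrier (psh Q X)" for \<sigma> \<sigma>'
  proof -
    note u = psh_chom_Hom[OF X \<sigma> \<sigma>']
    have "chom (psh Q X) \<sigma> \<sigma>' \<cdot> snd (psh_image Q X Y f \<sigma>) y () \<preceq> snd (psh_image Q X Y f \<sigma>') y ()"
      if y: "y \<in> carrier Y" for y
    proof -
      note t = psh_Hom[OF Y mem[OF \<sigma>'] y, simplified]
      have "chom (psh Q X) \<sigma> \<sigma>' \<cdot> (snd \<sigma> x () \<cdot> chom Y y (f x)) \<preceq> snd (psh_image Q X Y f \<sigma>') y ()"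
        if x: "x \<in> carrier X" for x
      proof -
        note c = chom_Hom[OF Y y fX[OF x], unfolded fty[OF x]]
        note s = psh_Hom[OF X \<sigma> x] and s' = psh_Hom[OF X \<sigma>' x]
        show ?thesis
          unfolding Comp_assoc[OF c s u]
          using Le_trans[OF Comp_mono_left[OF psh_chom_Comp_Le[OF X \<sigma> \<sigma>' x] Comp_Hom[OF s u] s' c]
              Le_psh_image[OF f \<sigma>' y x] Comp_Hom[OF c Comp_Hom[OF s u]] Comp_Hom[OF c s'] t] .
      qed
      then show ?thesis using Comp_psh_image_Le_iff[OF f \<sigma> y u t] by blast
    qed
    then show ?thesis using Le_psh_chom_iff[OF Y mem[OF \<sigma>] mem[OF \<sigma>']] u by simp
  qed
  then show ?thesis
    using mem qcategory_psh[OF X] qcategory_psh[OF Y] by (auto simp: qfunctor_def)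
qed

text \<open>
  When \<open>a\<close> represents \<open>Y(y, g -)\<close>, the supremum defining the image at \<open>y\<close> is a Yoneda supremum
  and collapses to the value at \<open>a\<close>.  Asking for \<open>a\<close> at a single \<open>y\<close> only, instead of a left
  adjoint of \<open>g\<close>, also covers functors whose adjoint is known just on part of their codomain, such
  as \<open>\<lambda>\<^sub>X\<close> at representable presheaves.
\<close>

lemma psh_image_right_adjoint:
  assumes g: "qfunctor Q X Y g" and \<sigma>: "\<sigma> \<in> carrier (psh Q X)" and y: "y \<in> carrier Y"
    and a: "a \<in> carrier X" "ty X a = ty Y y"
    and adj: "\<And>x. x \<in> carrier X \<Longrightarrow> chom Y y (g x) = chom X a x"
  shows "snd (psh_image Q X Y g \<sigma>) y () = snd \<sigma> a ()"
proof -
  note X = qfunctor_dom[OF g]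
  note sq = psh_qrel[OF X \<sigma>] and s = psh_Hom[OF X \<sigma>]
  show ?thesis
    unfolding psh_image_def snd_conv
    using y a s[OF a(1)] Le_Comp_chom[OF X a(1) s] psh_Comp_chom_Le[OF X \<sigma> _ a(1)] adj
    by (intro qrel_comp_eqI[OF cograph_qrel[OF g] sq y, where y = a]) (auto simp: cograph_def)
qed


section \<open>Copresheaves\<close>

lemma ty_copsh [simp]: "ty (copsh Q X) = fst"
  by (simp add: copsh_def)

lemma mem_copsh_iff:
  assumes X: "qcategory Q X"
  shows "\<tau> \<in> carrier (copsh Q X) \<longleftrightarrow>
    fst \<tau> \<in> Obj Q \<and> snd \<tau> \<in> qrel Q (one_cat Q (fst \<tau>)) X \<and>
    (\<forall>x \<in> carrier X. \<forall>x' \<in> carrier X. chom X x x' \<cdot> snd \<tau> () x \<preceq> snd \<tau> () x')"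
proof -
  have "distributor Q (one_cat Q s) X \<phi> \<longleftrightarrow>
      (\<forall>x \<in> carrier X. \<forall>x' \<in> carrier X. chom X x x' \<cdot> \<phi> () x \<preceq> \<phi> () x')"
    if s: "s \<in> Obj Q" and \<phi>: "\<phi> \<in> qrel Q (one_cat Q s) X" for s \<phi>
  proof -
    let ?\<psi> = "qrel_comp Q (one_cat Q s) X X (chom X) \<phi>"
    have "distributor Q (one_cat Q s) X \<phi> \<longleftrightarrow> (\<forall>x \<in> carrier X. ?\<psi> () x \<preceq> \<phi> () x)"
      using \<phi> one_cat_comp_right[OF \<phi> qcategory_ty[OF X] s] by (simp add: distributor_def qrel_le_def)
    moreover have "?\<psi> () x' \<preceq> \<phi> () x' \<longleftrightarrow> (\<forall>x \<in> carrier X. chom X x x' \<cdot> \<phi> () x \<preceq> \<phi> () x')"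
      if "x' \<in> carrier X" for x'
      using qrel_comp_Le_iff[OF \<phi> qcategory_chom[OF X] _ that _ ty_Obj[OF X that]]
        qrel_Hom[OF \<phi> _ that] s
      by simp
    ultimately show ?thesis by blast
  qed
  moreover have "distributor Q (one_cat Q s) X \<phi> \<Longrightarrow> \<phi> \<in> qrel Q (one_cat Q s) X" for s \<phi>
    by (simp add: distributor_def)
  ultimately show ?thesis
    by (cases \<tau>) (auto simp: copsh_def copsh_carrier_def)
qed

lemma
  assumes "qcategory Q X" "\<tau> \<in> carrier (copsh Q X)"
  shows copsh_Obj: "fst \<tau> \<in> Obj Q"
    and copsh_qrel: "snd \<tau> \<in> qrel Q (one_cat Q (fst \<tau>)) X"
    and copsh_Hom: "x \<in> carrier X \<Longrightarrow> snd \<tau> () x \<in> Hom Q (fst \<tau>) (ty X x)"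
    and copsh_chom_Comp_at_Le:
      "x \<in> carrier X \<Longrightarrow> x' \<in> carrier X \<Longrightarrow> chom X x x' \<cdot> snd \<tau> () x \<preceq> snd \<tau> () x'"
  using assms qrel_Hom[of "snd \<tau>" "one_cat Q (fst \<tau>)" X "()" x] by (auto simp: mem_copsh_iff)

lemma copsh_eqI:
  assumes "qcategory Q X" "\<tau> \<in> carrier (copsh Q X)" "\<tau>' \<in> carrier (copsh Q X)"
    "fst \<tau> = fst \<tau>'" "\<And>x. x \<in> carrier X \<Longrightarrow> snd \<tau> () x = snd \<tau>' () x"
  shows "\<tau> = \<tau>'"
  using qrel_eqI[OF copsh_qrel[OF assms(1,2)] copsh_qrel[OF assms(1,3), folded assms(4)]] assms(4,5)
  by (auto simp: prod_eq_iff)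

lemma
  assumes X: "qcategory Q X" and \<tau>: "\<tau> \<in> carrier (copsh Q X)" and \<tau>': "\<tau>' \<in> carrier (copsh Q X)"
  shows copsh_chom_Hom: "chom (copsh Q X) \<tau> \<tau>' \<in> Hom Q (fst \<tau>) (fst \<tau>')"
    and Le_copsh_chom_iff: "u \<in> Hom Q (fst \<tau>) (fst \<tau>') \<Longrightarrow>
      u \<preceq> chom (copsh Q X) \<tau> \<tau>' \<longleftrightarrow> (\<forall>x \<in> carrier X. snd \<tau>' () x \<cdot> u \<preceq> snd \<tau> () x)"
proof -
  let ?A = "(\<lambda>x. resid_right Q (snd \<tau>' () x) (snd \<tau> () x)) ` carrier X"
  have eq: "chom (copsh Q X) \<tau> \<tau>' = \<Sqinter>\<^bsub>hom_lat Q (fst \<tau>) (fst \<tau>')\<^esub> ?A"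
    using \<tau> \<tau>' by (simp add: copsh_def)
  have A: "?A \<subseteq> Hom Q (fst \<tau>) (fst \<tau>')"
    using resid_right_Hom[OF copsh_Hom[OF X \<tau>'] copsh_Hom[OF X \<tau>]] by blast
  note inf = copsh_Obj[OF X \<tau>] copsh_Obj[OF X \<tau>'] A
  show "chom (copsh Q X) \<tau> \<tau>' \<in> Hom Q (fst \<tau>) (fst \<tau>')"
    unfolding eq by (rule Inf_Hom[OF inf])
  show "u \<preceq> chom (copsh Q X) \<tau> \<tau>' \<longleftrightarrow> (\<forall>x \<in> carrier X. snd \<tau>' () x \<cdot> u \<preceq> snd \<tau> () x)"
    if "u \<in> Hom Q (fst \<tau>) (fst \<tau>')"
    unfolding eq Le_Inf_iff[OF inf that]
    using Le_resid_right_iff[OF copsh_Hom[OF X \<tau>'] copsh_Hom[OF X \<tau>] that] by simp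
qed

lemma copsh_at_Comp_chom_Le:
  assumes "qcategory Q X" "\<tau> \<in> carrier (copsh Q X)" "\<tau>' \<in> carrier (copsh Q X)" "x \<in> carrier X"
  shows "snd \<tau>' () x \<cdot> chom (copsh Q X) \<tau> \<tau>' \<preceq> snd \<tau> () x"
  using Le_copsh_chom_iff[OF assms(1-3) copsh_chom_Hom[OF assms(1-3)]]
    Le_refl[OF copsh_chom_Hom[OF assms(1-3)]] assms(4) by blast

lemma qcategory_copsh:
  assumes X: "qcategory Q X"
  shows "qcategory Q (copsh Q X)"
  unfolding qcategory_iff
proof (intro conjI ballI)
  show "ty (copsh Q X) \<in> carrier (copsh Q X) \<rightarrow> Obj Q" using copsh_Obj[OF X] by auto
  have "chom (copsh Q X) =
      (\<lambda>\<tau> \<in> carrier (copsh Q X). \<lambda>\<tau>' \<in> carrier (copsh Q X). chom (copsh Q X) \<tau> \<tau>')"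
    by (auto simp: copsh_def fun_eq_iff)
  moreover have "\<dots> \<in> qrel Q (copsh Q X) (copsh Q X)"
    using copsh_chom_Hom[OF X] by (simp add: qrel_def)
  ultimately show "chom (copsh Q X) \<in> qrel Q (copsh Q X) (copsh Q X)" by simp
next
  fix \<tau> assume \<tau>: "\<tau> \<in> carrier (copsh Q X)"
  then show "Idn Q (ty (copsh Q X) \<tau>) \<preceq> chom (copsh Q X) \<tau> \<tau>"
    using Le_copsh_chom_iff[OF X \<tau> \<tau> Idn_Hom[OF copsh_Obj[OF X \<tau>]]]
      Comp_Idn_right[OF copsh_Hom[OF X \<tau>]] Le_refl[OF copsh_Hom[OF X \<tau>]] by simp
next
  fix \<rho> \<sigma> \<tau> assume \<rho>: "\<rho> \<in> carrier (copsh Q X)" and \<sigma>: "\<sigma> \<in> carrier (copsh Q X)"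
    and \<tau>: "\<tau> \<in> carrier (copsh Q X)"
  note u = copsh_chom_Hom[OF X \<rho> \<sigma>] and v = copsh_chom_Hom[OF X \<sigma> \<tau>]
  have "snd \<tau> () x \<cdot> (chom (copsh Q X) \<sigma> \<tau> \<cdot> chom (copsh Q X) \<rho> \<sigma>) \<preceq> snd \<rho> () x"
    if x: "x \<in> carrier X" for x
  proof -
    note r = copsh_Hom[OF X \<rho> x] and s = copsh_Hom[OF X \<sigma> x] and t = copsh_Hom[OF X \<tau> x]
    show ?thesis
      unfolding Comp_assoc[OF u v t]
      using Le_trans[OF Comp_mono_left[OF copsh_at_Comp_chom_Le[OF X \<sigma> \<tau> x] Comp_Hom[OF v t] s u]
          copsh_at_Comp_chom_Le[OF X \<rho> \<sigma> x] Comp_Hom[OF u Comp_Hom[OF v t]] Comp_Hom[OF u s] r] .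
  qed
  then show "chom (copsh Q X) \<sigma> \<tau> \<cdot> chom (copsh Q X) \<rho> \<sigma> \<preceq> chom (copsh Q X) \<rho> \<tau>"
    by (simp add: Le_copsh_chom_iff[OF X \<rho> \<tau> Comp_Hom[OF u v]])
qed

lemma coyoneda_simps [simp]:
  "fst (coyoneda X x) = ty X x" "x' \<in> carrier X \<Longrightarrow> snd (coyoneda X x) () x' = chom X x x'"
  by (auto simp: coyoneda_def)

lemma coyoneda_mem_copsh:
  assumes "qcategory Q X" "x \<in> carrier X"
  shows "coyoneda X x \<in> carrier (copsh Q X)"
proof -
  have "snd (coyoneda X x) \<in> qrel Q (one_cat Q (ty X x)) X"
    using chom_Hom[OF assms] by (auto simp: coyoneda_def qrel_def PiE_iff extensional_def)
  then show ?thesis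
    using assms by (auto simp: mem_copsh_iff ty_Obj chom_Comp_Le)
qed

lemma coyoneda_lemma:
  assumes X: "qcategory Q X" and x: "x \<in> carrier X" and \<tau>: "\<tau> \<in> carrier (copsh Q X)"
  shows "chom (copsh Q X) \<tau> (coyoneda X x) = snd \<tau> () x"
proof -
  note y = coyoneda_mem_copsh[OF X x] and t = copsh_Hom[OF X \<tau>]
  note H = copsh_chom_Hom[OF X \<tau> y, simplified]
  show ?thesis
  proof (rule Hom_eqI[OF H t[OF x]])
    fix u assume u: "u \<in> Hom Q (fst \<tau>) (ty X x)"
    have "(\<forall>x' \<in> carrier X. chom X x x' \<cdot> u \<preceq> snd \<tau> () x') \<longleftrightarrow> u \<preceq> snd \<tau> () x"
    proof safe
      assume "\<forall>x' \<in> carrier X. chom X x x' \<cdot> u \<preceq> snd \<tau> () x'"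
      then show "u \<preceq> snd \<tau> () x"
        using Le_trans[OF Le_chom_Comp[OF X x u] _ u Comp_Hom[OF u chom_Hom[OF X x x]] t[OF x]] x
        by blast
    next
      fix x' assume le: "u \<preceq> snd \<tau> () x" and x': "x' \<in> carrier X"
      note c = chom_Hom[OF X x x']
      show "chom X x x' \<cdot> u \<preceq> snd \<tau> () x'"
        using Le_trans[OF Comp_mono_right[OF le u t[OF x] c] copsh_chom_Comp_at_Le[OF X \<tau> x x']
            Comp_Hom[OF u c] Comp_Hom[OF t[OF x] c] t[OF x']] .
    qed
    then show "u \<preceq> chom (copsh Q X) \<tau> (coyoneda X x) \<longleftrightarrow> u \<preceq> snd \<tau> () x"
      using Le_copsh_chom_iff[OF X \<tau> y] u by simp
  qed
qed

lemma qfunctor_coyoneda: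
  assumes X: "qcategory Q X"
  shows "qfunctor Q X (copsh Q X) (coyoneda X)"
  using assms qcategory_copsh[OF X] coyoneda_mem_copsh[OF X] Le_refl[OF chom_Hom[OF X]]
  by (auto simp: qfunctor_def coyoneda_lemma)

lemma copsh_preimage_ty [simp]: "fst (copsh_preimage Q X Y f \<tau>) = fst \<tau>"
  by (simp add: copsh_preimage_def)

lemma
  assumes f: "qfunctor Q X Y f" and \<tau>: "\<tau> \<in> carrier (copsh Q Y)"
  shows copsh_preimage_mem: "copsh_preimage Q X Y f \<tau> \<in> carrier (copsh Q X)"
    and copsh_preimage_at: "x \<in> carrier X \<Longrightarrow> snd (copsh_preimage Q X Y f \<tau>) () x = snd \<tau> () (f x)"
proof -
  note X = qfunctor_dom[OF f] and Y = qfunctor_cod[OF f] and fX = qfunctor_carrier[OF f]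
    and fty = qfunctor_ty[OF f]
  note t = copsh_Hom[OF Y \<tau>] and tq = copsh_qrel[OF Y \<tau>] and O = copsh_Obj[OF Y \<tau>]
  have tf: "snd \<tau> () (f x) \<in> Hom Q (fst \<tau>) (ty X x)" if "x \<in> carrier X" for x
    using t[OF fX[OF that]] fty[OF that] by simp
  let ?\<tau> = "copsh_preimage Q X Y f \<tau>"
  have at: "snd ?\<tau> () x = snd \<tau> () (f x)" if x: "x \<in> carrier X" for x
    unfolding copsh_preimage_def snd_conv
    using x fX[OF x] fty[OF x] tf[OF x] Le_chom_Comp[OF Y fX[OF x] t]
      copsh_chom_Comp_at_Le[OF Y \<tau> _ fX[OF x]]
    by (intro qrel_comp_eqI[OF tq cograph_qrel[OF f] _ x, where y = "f x"]) (auto simp: cograph_def)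
  have "snd ?\<tau> \<in> qrel Q (one_cat Q (fst \<tau>)) X"
    unfolding copsh_preimage_def snd_conv
    using O by (intro qrel_comp_qrel[OF tq cograph_qrel[OF f] _ qcategory_ty[OF X]]) auto
  moreover have "chom X x x' \<cdot> snd \<tau> () (f x) \<preceq> snd \<tau> () (f x')"
    if x: "x \<in> carrier X" and x': "x' \<in> carrier X" for x x'
  proof -
    note c = chom_Hom[OF X x x']
    note c' = chom_Hom[OF Y fX[OF x] fX[OF x'], unfolded fty[OF x] fty[OF x']]
    show ?thesis
      using Le_trans[OF Comp_mono_left[OF qfunctor_chom[OF f x x'] c c' tf[OF x]]
          copsh_chom_Comp_at_Le[OF Y \<tau> fX[OF x] fX[OF x']]
          Comp_Hom[OF tf[OF x] c] Comp_Hom[OF tf[OF x] c'] tf[OF x']] .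
  qed
  ultimately show "?\<tau> \<in> carrier (copsh Q X)"
    unfolding mem_copsh_iff[OF X] using O at by simp
  show "x \<in> carrier X \<Longrightarrow> snd ?\<tau> () x = snd \<tau> () (f x)" by (rule at)
qed

lemma qfunctor_copsh_preimage:
  assumes f: "qfunctor Q X Y f"
  shows "qfunctor Q (copsh Q Y) (copsh Q X) (copsh_preimage Q X Y f)"
proof -
  note X = qfunctor_dom[OF f] and Y = qfunctor_cod[OF f] and fX = qfunctor_carrier[OF f]
  note mem = copsh_preimage_mem[OF f]
  have "chom (copsh Q Y) \<tau> \<tau>' \<preceq> chom (copsh Q X) (copsh_preimage Q X Y f \<tau>) (copsh_preimage Q X Y f \<tau>')"
    if \<tau>: "\<tau> \<in> carrier (copsh Q Y)" "\<tau>' \<in> carrier (copsh Q Y)" for \<tau> \<tau>'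
    using copsh_at_Comp_chom_Le[OF Y \<tau>] copsh_chom_Hom[OF Y \<tau>] fX copsh_preimage_at[OF f] \<tau>
    by (subst Le_copsh_chom_iff[OF X mem mem]) auto
  then show ?thesis
    using mem qcategory_copsh[OF X] qcategory_copsh[OF Y] by (auto simp: qfunctor_def)
qed

lemma copsh_image_ty [simp]: "fst (copsh_image Q X Y f \<tau>) = fst \<tau>"
  by (simp add: copsh_image_def)

lemma copsh_image_mem:
  assumes f: "qfunctor Q X Y f" and \<tau>: "\<tau> \<in> carrier (copsh Q X)"
  shows "copsh_image Q X Y f \<tau> \<in> carrier (copsh Q Y)"
proof -
  note X = qfunctor_dom[OF f] and Y = qfunctor_cod[OF f] and fX = qfunctor_carrier[OF f]
    and fty = qfunctor_ty[OF f]
  note t = copsh_Hom[OF X \<tau>] and tq = copsh_qrel[OF X \<tau>] and O = copsh_Obj[OF X \<tau>]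
  note gr = graph_qrel[OF f]
  let ?\<rho> = "qrel_comp Q (one_cat Q (fst \<tau>)) X Y (graph X Y f) (snd \<tau>)"
  have \<rho>: "?\<rho> \<in> qrel Q (one_cat Q (fst \<tau>)) Y"
    using O by (intro qrel_comp_qrel[OF tq gr _ qcategory_ty[OF Y]]) auto
  have "chom Y y y' \<cdot> ?\<rho> () y \<preceq> ?\<rho> () y'" if y: "y \<in> carrier Y" and y': "y' \<in> carrier Y" for y y'
  proof -
    note c = chom_Hom[OF Y y y']
    have \<rho>': "?\<rho> () y' \<in> Hom Q (fst \<tau>) (ty Y y')" using qrel_Hom[OF \<rho> _ y'] by simp
    have "chom Y y y' \<cdot> (graph X Y f x y \<cdot> snd \<tau> () x) \<preceq> ?\<rho> () y'" if x: "x \<in> carrier X" for x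
    proof -
      note d = chom_Hom[OF Y fX[OF x] y, unfolded fty[OF x]]
        and d' = chom_Hom[OF Y fX[OF x] y', unfolded fty[OF x]]
      have "(chom Y y y' \<cdot> chom Y (f x) y) \<cdot> snd \<tau> () x \<preceq> chom Y (f x) y' \<cdot> snd \<tau> () x"
        by (rule Comp_mono_left[OF chom_Comp_Le[OF Y fX[OF x] y y'] Comp_Hom[OF d c] d' t[OF x]])
      moreover have "chom Y (f x) y' \<cdot> snd \<tau> () x \<preceq> ?\<rho> () y'"
        using Le_qrel_comp[OF tq gr _ y' _ ty_Obj[OF Y y'] x, of "()"] O x y'
        by (simp add: graph_def)
      ultimately show ?thesis
        using Le_trans[OF _ _ Comp_Hom[OF t[OF x] Comp_Hom[OF d c]] Comp_Hom[OF t[OF x] d'] \<rho>']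
          Comp_assoc[OF t[OF x] d c] x y by (simp add: graph_def)
    qed
    then show ?thesis
      using Comp_qrel_comp_Le_iff[OF tq gr _ y _ ty_Obj[OF Y y] c, of "()"] \<rho>' O by simp
  qed
  then show ?thesis
    unfolding mem_copsh_iff[OF Y] using O \<rho> by (simp add: copsh_image_def)
qed

text \<open>
  Since \<open>f\<^sub>* \<circ> \<tau> \<preceq> \<tau>'\<close> is the same as \<open>\<tau> \<preceq> f\<^sup>* \<circ> \<tau>'\<close>, and since the order of copresheaves is
  opposite to \<open>\<preceq>\<close>, restricting copresheaves is left adjoint to pushing them forward.
\<close>

lemma copsh_preimage_image_adjoint:
  assumes f: "qfunctor Q X Y f" and \<tau>: "\<tau> \<in> carrier (copsh Q X)" and \<tau>': "\<tau>' \<in> carrier (copsh Q Y)"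
  shows "chom (copsh Q Y) \<tau>' (copsh_image Q X Y f \<tau>) = chom (copsh Q X) (copsh_preimage Q X Y f \<tau>') \<tau>"
proof -
  note X = qfunctor_dom[OF f] and Y = qfunctor_cod[OF f] and fX = qfunctor_carrier[OF f]
    and fty = qfunctor_ty[OF f]
  note im = copsh_image_mem[OF f \<tau>] and pre = copsh_preimage_mem[OF f \<tau>']
  note t = copsh_Hom[OF X \<tau>] and t' = copsh_Hom[OF Y \<tau>']
  note tq = copsh_qrel[OF X \<tau>] and O = copsh_Obj[OF X \<tau>] and gr = graph_qrel[OF f]
  show ?thesis
  proof (rule Hom_eqI)
    show "chom (copsh Q Y) \<tau>' (copsh_image Q X Y f \<tau>) \<in> Hom Q (fst \<tau>') (fst \<tau>)"
      using copsh_chom_Hom[OF Y \<tau>' im] by simp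
    show "chom (copsh Q X) (copsh_preimage Q X Y f \<tau>') \<tau> \<in> Hom Q (fst \<tau>') (fst \<tau>)"
      using copsh_chom_Hom[OF X pre \<tau>] by simp
    fix u assume u: "u \<in> Hom Q (fst \<tau>') (fst \<tau>)"
    have transpose: "(\<forall>y \<in> carrier Y. (chom Y (f x) y \<cdot> snd \<tau> () x) \<cdot> u \<preceq> snd \<tau>' () y)
        \<longleftrightarrow> snd \<tau> () x \<cdot> u \<preceq> snd \<tau>' () (f x)" if x: "x \<in> carrier X" for x
    proof -
      note tx = t[OF x] and t'x = t'[OF fX[OF x], unfolded fty[OF x]]
      note tu = Comp_Hom[OF u tx]
      note c = chom_Hom[OF Y fX[OF x], unfolded fty[OF x]]
      have "(chom Y (f x) y \<cdot> snd \<tau> () x) \<cdot> u = chom Y (f x) y \<cdot> (snd \<tau> () x \<cdot> u)"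
        if "y \<in> carrier Y" for y
        using Comp_assoc[OF u tx c[OF that]] by simp
      moreover have "(\<forall>y \<in> carrier Y. chom Y (f x) y \<cdot> (snd \<tau> () x \<cdot> u) \<preceq> snd \<tau>' () y)
        \<longleftrightarrow> snd \<tau> () x \<cdot> u \<preceq> snd \<tau>' () (f x)"
      proof safe
        assume "\<forall>y \<in> carrier Y. chom Y (f x) y \<cdot> (snd \<tau> () x \<cdot> u) \<preceq> snd \<tau>' () y"
        then show "snd \<tau> () x \<cdot> u \<preceq> snd \<tau>' () (f x)"
          using Le_trans[OF Le_chom_Comp[OF Y fX[OF x]] _ tu Comp_Hom[OF tu] t'x]
            c[OF fX[OF x]] tu fX[OF x] fty[OF x] by auto
      next
        fix y assume le: "snd \<tau> () x \<cdot> u \<preceq> snd \<tau>' () (f x)" and y: "y \<in> carrier Y"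
        show "chom Y (f x) y \<cdot> (snd \<tau> () x \<cdot> u) \<preceq> snd \<tau>' () y"
          using Le_trans[OF Comp_mono_right[OF le tu t'x c[OF y]]
              copsh_chom_Comp_at_Le[OF Y \<tau>' fX[OF x] y]
              Comp_Hom[OF tu c[OF y]] Comp_Hom[OF t'x c[OF y]] t'[OF y]] .
      qed
      ultimately show ?thesis by simp
    qed
    have "u \<preceq> chom (copsh Q Y) \<tau>' (copsh_image Q X Y f \<tau>) \<longleftrightarrow>
        (\<forall>y \<in> carrier Y. snd (copsh_image Q X Y f \<tau>) () y \<cdot> u \<preceq> snd \<tau>' () y)"
      using Le_copsh_chom_iff[OF Y \<tau>' im] u by simp
    also have "\<dots> \<longleftrightarrow> (\<forall>y \<in> carrier Y. \<forall>x \<in> carrier X. (chom Y (f x) y \<cdot> snd \<tau> () x) \<cdot> u \<preceq> snd \<tau>' () y)"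
      using qrel_comp_Comp_Le_iff[OF tq gr _ _ _ ty_Obj[OF Y], of "()"] O u t'
      by (simp add: copsh_image_def graph_def)
    also have "\<dots> \<longleftrightarrow> (\<forall>x \<in> carrier X. snd \<tau> () x \<cdot> u \<preceq> snd \<tau>' () (f x))"
      using transpose by blast
    also have "\<dots> \<longleftrightarrow> u \<preceq> chom (copsh Q X) (copsh_preimage Q X Y f \<tau>') \<tau>"
      using Le_copsh_chom_iff[OF X pre \<tau>] copsh_preimage_at[OF f \<tau>'] u by simp
    finally show "u \<preceq> chom (copsh Q Y) \<tau>' (copsh_image Q X Y f \<tau>) \<longleftrightarrow>
        u \<preceq> chom (copsh Q X) (copsh_preimage Q X Y f \<tau>') \<tau>" .
  qed
qed

text \<open>
  By the adjunction, functoriality of the push-forward reduces to the unit inequality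
  \<open>\<tau> \<preceq> f\<^sup>* \<circ> f\<^sub>* \<circ> \<tau>\<close>.
\<close>

lemma qfunctor_copsh_image:
  assumes f: "qfunctor Q X Y f"
  shows "qfunctor Q (copsh Q X) (copsh Q Y) (copsh_image Q X Y f)"
proof -
  note X = qfunctor_dom[OF f] and Y = qfunctor_cod[OF f]
  note mem = copsh_image_mem[OF f] and pmem = copsh_preimage_mem[OF f]
  have "chom (copsh Q X) \<tau> \<tau>' \<preceq> chom (copsh Q Y) (copsh_image Q X Y f \<tau>) (copsh_image Q X Y f \<tau>')"
    if \<tau>: "\<tau> \<in> carrier (copsh Q X)" and \<tau>': "\<tau>' \<in> carrier (copsh Q X)" for \<tau> \<tau>'
  proof -
    let ?C = "copsh Q X" and ?\<rho> = "copsh_preimage Q X Y f (copsh_image Q X Y f \<tau>)"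
    note C = qcategory_copsh[OF X] and \<rho> = pmem[OF mem[OF \<tau>]]
    note u = copsh_chom_Hom[OF X \<tau> \<tau>'] and v = copsh_chom_Hom[OF X \<rho> \<tau>, simplified]
      and w = copsh_chom_Hom[OF X \<rho> \<tau>', simplified]
    have "Idn Q (fst \<tau>) \<preceq> chom (copsh Q Y) (copsh_image Q X Y f \<tau>) (copsh_image Q X Y f \<tau>)"
      using Idn_Le_chom[OF qcategory_copsh[OF Y] mem[OF \<tau>]] by simp
    then have "Idn Q (fst \<tau>) \<preceq> chom ?C ?\<rho> \<tau>"
      by (simp add: copsh_preimage_image_adjoint[OF f \<tau> mem[OF \<tau>]])
    then have "chom ?C \<tau> \<tau>' \<preceq> chom ?C \<tau> \<tau>' \<cdot> chom ?C ?\<rho> \<tau>"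
      using Comp_mono_right[OF _ Idn_Hom[OF copsh_Obj[OF X \<tau>]] v u] Comp_Idn_right[OF u] by simp
    then have "chom ?C \<tau> \<tau>' \<preceq> chom ?C ?\<rho> \<tau>'"
      by (rule Le_trans[OF _ chom_Comp_Le[OF C \<rho> \<tau> \<tau>'] u Comp_Hom[OF v u] w])
    then show ?thesis
      by (simp add: copsh_preimage_image_adjoint[OF f \<tau>' mem[OF \<tau>]])
  qed
  then show ?thesis
    using mem qcategory_copsh[OF X] qcategory_copsh[OF Y] by (auto simp: qfunctor_def)
qed

section \<open>The distributive law\<close>

lemma copsh_mult_ty [simp]: "fst (copsh_mult Q X T) = fst T"
  by (simp add: copsh_mult_def)

lemma psh_mult_ty [simp]: "fst (psh_mult Q X \<Sigma>) = fst \<Sigma>"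
  by (simp add: psh_mult_def)

lemma
  assumes "qcategory Q X" "T \<in> carrier (copsh Q (copsh Q X))"
  shows copsh_mult_mem: "copsh_mult Q X T \<in> carrier (copsh Q X)"
    and copsh_mult_at: "x \<in> carrier X \<Longrightarrow> snd (copsh_mult Q X T) () x = snd T () (coyoneda X x)"
  unfolding copsh_mult_def
  by (rule copsh_preimage_mem[OF qfunctor_coyoneda[OF assms(1)] assms(2)],
    rule copsh_preimage_at[OF qfunctor_coyoneda[OF assms(1)] assms(2)])

text \<open>
  The left hom tests \<open>T\<close> on representable copresheaves only, the right one on all copresheaves.
  The second test follows from the first because every value \<open>\<rho>(x)\<close> is a hom from \<open>\<rho>\<close> to the
  copresheaf represented by \<open>x\<close>, so that \<open>\<rho>(x) \<circ> T(\<rho>)\<close> lies below the value of \<open>T\<close> there.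
\<close>

lemma coyoneda_copsh_mult_adjoint:
  assumes X: "qcategory Q X" and \<tau>: "\<tau> \<in> carrier (copsh Q X)" and T: "T \<in> carrier (copsh Q (copsh Q X))"
  shows "chom (copsh Q X) \<tau> (copsh_mult Q X T) = chom (copsh Q (copsh Q X)) (coyoneda (copsh Q X) \<tau>) T"
proof -
  let ?C = "copsh Q X"
  note C = qcategory_copsh[OF X]
  note m = copsh_mult_mem[OF X T] and y = coyoneda_mem_copsh[OF C \<tau>]
  show ?thesis
  proof (rule Hom_eqI)
    show "chom ?C \<tau> (copsh_mult Q X T) \<in> Hom Q (fst \<tau>) (fst T)"
      using copsh_chom_Hom[OF X \<tau> m] by simp
    show "chom (copsh Q ?C) (coyoneda ?C \<tau>) T \<in> Hom Q (fst \<tau>) (fst T)"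
      using copsh_chom_Hom[OF C y T] by simp
    fix u assume u: "u \<in> Hom Q (fst \<tau>) (fst T)"
    have "(\<forall>x \<in> carrier X. snd T () (coyoneda X x) \<cdot> u \<preceq> snd \<tau> () x)
        \<longleftrightarrow> (\<forall>\<rho> \<in> carrier ?C. snd T () \<rho> \<cdot> u \<preceq> chom ?C \<tau> \<rho>)"
    proof (intro iffI ballI)
      fix \<rho>
      assume le: "\<forall>x \<in> carrier X. snd T () (coyoneda X x) \<cdot> u \<preceq> snd \<tau> () x" and \<rho>: "\<rho> \<in> carrier ?C"
      note T\<rho> = copsh_Hom[OF C T \<rho>, simplified]
      have "snd \<rho> () x \<cdot> (snd T () \<rho> \<cdot> u) \<preceq> snd \<tau> () x" if x: "x \<in> carrier X" for x
      proof -
        note r = copsh_Hom[OF X \<rho> x] and t = copsh_Hom[OF X \<tau> x]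
        note yx = coyoneda_mem_copsh[OF X x]
        note Ty = copsh_Hom[OF C T yx, simplified]
        have "snd \<rho> () x \<cdot> snd T () \<rho> \<preceq> snd T () (coyoneda X x)"
          using copsh_chom_Comp_at_Le[OF C T \<rho> yx] by (simp add: coyoneda_lemma[OF X x \<rho>])
        then have "(snd \<rho> () x \<cdot> snd T () \<rho>) \<cdot> u \<preceq> snd T () (coyoneda X x) \<cdot> u"
          by (rule Comp_mono_left[OF _ Comp_Hom[OF T\<rho> r] Ty u])
        then have "(snd \<rho> () x \<cdot> snd T () \<rho>) \<cdot> u \<preceq> snd \<tau> () x"
          using Le_trans[OF _ _ Comp_Hom[OF u Comp_Hom[OF T\<rho> r]] Comp_Hom[OF u Ty] t] le x by blast
        then show ?thesis
          by (simp add: Comp_assoc[OF u T\<rho> r])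
      qed
      then show "snd T () \<rho> \<cdot> u \<preceq> chom ?C \<tau> \<rho>"
        by (simp add: Le_copsh_chom_iff[OF X \<tau> \<rho> Comp_Hom[OF u T\<rho>]])
    next
      fix x assume le: "\<forall>\<rho> \<in> carrier ?C. snd T () \<rho> \<cdot> u \<preceq> chom ?C \<tau> \<rho>" and x: "x \<in> carrier X"
      show "snd T () (coyoneda X x) \<cdot> u \<preceq> snd \<tau> () x"
        using bspec[OF le coyoneda_mem_copsh[OF X x]] by (simp add: coyoneda_lemma[OF X x \<tau>])
    qed
    then show "u \<preceq> chom ?C \<tau> (copsh_mult Q X T) \<longleftrightarrow> u \<preceq> chom (copsh Q ?C) (coyoneda ?C \<tau>) T"
      using Le_copsh_chom_iff[OF X \<tau> m] Le_copsh_chom_iff[OF C y T] copsh_mult_at[OF X T] u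
      by simp
  qed
qed

abbreviation copsh_yoneda ::
  "('a, 'o, 'm) qcategory \<Rightarrow> ('a, 'o, 'm) copresheaf \<Rightarrow> (('a, 'o, 'm) presheaf, 'o, 'm) copresheaf"
  where "copsh_yoneda X \<equiv> copsh_image Q X (psh Q X) (yoneda X)"

lemma qfunctor_copsh_yoneda:
  "qcategory Q X \<Longrightarrow> qfunctor Q (copsh Q X) (copsh Q (psh Q X)) (copsh_yoneda X)"
  by (intro qfunctor_copsh_image qfunctor_yoneda)

text \<open>
  The Yoneda lemma turns the graph of the Yoneda embedding at \<open>(x, \<sigma>)\<close> into \<open>\<sigma>(x)\<close>.  Having the
  pairing of \<open>\<sigma>\<close> and \<open>\<tau>\<close> as a composite of relations makes associativity applicable.
\<close>

lemma copsh_yoneda_at: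
  assumes X: "qcategory Q X" and \<sigma>: "\<sigma> \<in> carrier (psh Q X)"
  shows "snd (copsh_yoneda X \<tau>) () \<sigma>
    = qrel_comp Q (one_cat Q (fst \<tau>)) X (one_cat Q (fst \<sigma>)) (snd \<sigma>) (snd \<tau>) () ()"
  unfolding copsh_image_def snd_conv qrel_comp_def
  using \<sigma> yoneda_lemma[OF X _ \<sigma>] by (simp add: graph_def cong: image_cong)

lemma copsh_yoneda_yoneda:
  assumes X: "qcategory Q X" and \<tau>: "\<tau> \<in> carrier (copsh Q X)" and x: "x \<in> carrier X"
  shows "snd (copsh_yoneda X \<tau>) () (yoneda X x) = snd \<tau> () x"
  unfolding copsh_yoneda_at[OF X yoneda_mem_psh[OF X x]]
  using copsh_Hom[OF X \<tau> x] Le_chom_Comp[OF X x copsh_Hom[OF X \<tau> x]]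
    copsh_chom_Comp_at_Le[OF X \<tau> _ x] x psh_qrel[OF X yoneda_mem_psh[OF X x]]
  by (intro qrel_comp_eqI[OF copsh_qrel[OF X \<tau>], where y = x]) auto

lemma copsh_yoneda_coyoneda:
  assumes X: "qcategory Q X" and x: "x \<in> carrier X" and \<sigma>: "\<sigma> \<in> carrier (psh Q X)"
  shows "snd (copsh_yoneda X (coyoneda X x)) () \<sigma> = snd \<sigma> x ()"
  unfolding copsh_yoneda_at[OF X \<sigma>]
  using psh_Hom[OF X \<sigma> x] Le_Comp_chom[OF X x psh_Hom[OF X \<sigma> x]]
    psh_Comp_chom_Le[OF X \<sigma> _ x] x copsh_qrel[OF X coyoneda_mem_copsh[OF X x]]
  by (intro qrel_comp_eqI[OF _ psh_qrel[OF X \<sigma>], where y = x]) auto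

text \<open>
  By the adjunction it suffices that restricting along the Yoneda embedding recovers \<open>\<tau>\<close>, which is
  \<open>copsh_yoneda_yoneda\<close>.
\<close>

lemma copsh_yoneda_fully_faithful:
  assumes X: "qcategory Q X" and \<tau>: "\<tau> \<in> carrier (copsh Q X)" and \<tau>': "\<tau>' \<in> carrier (copsh Q X)"
  shows "chom (copsh Q (psh Q X)) (copsh_yoneda X \<tau>) (copsh_yoneda X \<tau>') = chom (copsh Q X) \<tau> \<tau>'"
proof -
  note y = qfunctor_yoneda[OF X]
  note h = qfunctor_carrier[OF qfunctor_copsh_yoneda[OF X] \<tau>]
  have "copsh_preimage Q X (psh Q X) (yoneda X) (copsh_yoneda X \<tau>) = \<tau>"
    using copsh_preimage_mem[OF y h] \<tau>
    by (rule copsh_eqI[OF X]) (simp_all add: copsh_preimage_at[OF y h] copsh_yoneda_yoneda[OF X \<tau>])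
  then show ?thesis
    by (simp add: copsh_preimage_image_adjoint[OF y \<tau>' h])
qed

text \<open>At \<open>\<sigma>\<close> this reads \<open>(\<sigma> \<circ> f\<^sup>*) \<circ> \<tau> = \<sigma> \<circ> (f\<^sup>* \<circ> \<tau>)\<close>.\<close>

lemma copsh_yoneda_natural:
  assumes f: "qfunctor Q X Y f" and \<tau>: "\<tau> \<in> carrier (copsh Q Y)"
  shows "copsh_preimage Q (psh Q X) (psh Q Y) (psh_image Q X Y f) (copsh_yoneda Y \<tau>)
    = copsh_yoneda X (copsh_preimage Q X Y f \<tau>)"
proof -
  note X = qfunctor_dom[OF f] and Y = qfunctor_cod[OF f]
  note im = qfunctor_psh_image[OF f]
  note hX = qfunctor_carrier[OF qfunctor_copsh_yoneda[OF X]]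
    and hY = qfunctor_carrier[OF qfunctor_copsh_yoneda[OF Y] \<tau>]
  note pre = copsh_preimage_mem[OF f \<tau>]
  have "snd (copsh_yoneda Y \<tau>) () (psh_image Q X Y f \<sigma>)
      = snd (copsh_yoneda X (copsh_preimage Q X Y f \<tau>)) () \<sigma>" if \<sigma>: "\<sigma> \<in> carrier (psh Q X)" for \<sigma>
    unfolding copsh_yoneda_at[OF X \<sigma>] copsh_yoneda_at[OF Y qfunctor_carrier[OF im \<sigma>]]
    using qrel_comp_assoc[OF copsh_qrel[OF Y \<tau>] cograph_qrel[OF f] psh_qrel[OF X \<sigma>]
        _ qcategory_ty[OF Y] qcategory_ty[OF X]] copsh_Obj[OF Y \<tau>] psh_Obj[OF X \<sigma>]
    by (simp add: psh_image_def copsh_preimage_def)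
  with copsh_preimage_mem[OF im hY] hX[OF pre] show ?thesis
    by (intro copsh_eqI[OF qcategory_psh[OF X]]) (simp_all add: copsh_preimage_at[OF im hY])
qed

lemma qfunctor_psh_mult:
  "qcategory Q X \<Longrightarrow> qfunctor Q (psh Q (psh Q X)) (psh Q X) (psh_mult Q X)"
  unfolding psh_mult_def by (intro qfunctor_psh_preimage qfunctor_yoneda)

text \<open>
  At \<open>\<Sigma>\<close> this reads \<open>(\<Sigma> \<circ> \<phi>) \<circ> \<tau> = \<Sigma> \<circ> (\<phi> \<circ> \<tau>)\<close> with \<open>\<phi>\<close> the graph of the Yoneda
  embedding: on the left \<open>\<Sigma> \<circ> \<phi>\<close> is the product of \<open>\<Sigma>\<close> in the presheaf monad, on the right
  \<open>\<phi> \<circ> \<tau>\<close> is \<open>copsh_yoneda X \<tau>\<close>.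
\<close>

lemma copsh_yoneda_psh_mult:
  assumes X: "qcategory Q X" and \<tau>: "\<tau> \<in> carrier (copsh Q X)"
  shows "copsh_preimage Q (psh Q (psh Q X)) (psh Q X) (psh_mult Q X) (copsh_yoneda X \<tau>)
    = copsh_yoneda (psh Q X) (copsh_yoneda X \<tau>)"
proof -
  note P = qcategory_psh[OF X] and s = qfunctor_psh_mult[OF X]
  note h = qfunctor_carrier[OF qfunctor_copsh_yoneda[OF X] \<tau>]
  note hh = qfunctor_carrier[OF qfunctor_copsh_yoneda[OF P] h]
  have "snd (copsh_yoneda X \<tau>) () (psh_mult Q X \<Sigma>)
      = snd (copsh_yoneda (psh Q X) (copsh_yoneda X \<tau>)) () \<Sigma>"
    if \<Sigma>: "\<Sigma> \<in> carrier (psh Q (psh Q X))" for \<Sigma>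
    unfolding copsh_yoneda_at[OF P \<Sigma>] copsh_yoneda_at[OF X qfunctor_carrier[OF s \<Sigma>]]
    using qrel_comp_assoc[OF copsh_qrel[OF X \<tau>] graph_qrel[OF qfunctor_yoneda[OF X]] psh_qrel[OF P \<Sigma>]
        _ qcategory_ty[OF X] qcategory_ty[OF P]] copsh_Obj[OF X \<tau>] psh_Obj[OF P \<Sigma>]
    by (simp add: psh_mult_def psh_preimage_def copsh_image_def)
  with copsh_preimage_mem[OF s h] hh show ?thesis
    by (intro copsh_eqI[OF qcategory_psh[OF P]]) (simp_all add: copsh_preimage_at[OF s h])
qed

lemma lambda_dag_ty [simp]: "fst (lambda_dag Q X \<Theta>) = fst \<Theta>"
  by (simp add: lambda_dag_def transpose_psh_def)

lemma lambda_dag_at: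
  assumes "\<Theta> \<in> carrier (copsh Q (psh Q X))" "\<tau> \<in> carrier (copsh Q X)"
  shows "snd (lambda_dag Q X \<Theta>) \<tau> () = chom (copsh Q (psh Q X)) (copsh_yoneda X \<tau>) \<Theta>"
  using assms by (simp add: lambda_dag_def transpose_psh_def graph_def)

lemma lambda_dag_eq_preimage:
  assumes X: "qcategory Q X" and \<Theta>: "\<Theta> \<in> carrier (copsh Q (psh Q X))"
  shows "lambda_dag Q X \<Theta> = psh_preimage Q (copsh Q X) (copsh Q (psh Q X)) (copsh_yoneda X)
    (yoneda (copsh Q (psh Q X)) \<Theta>)" (is "_ = ?\<sigma>")
proof -
  note C = qcategory_copsh[OF X] and CP = qcategory_copsh[OF qcategory_psh[OF X]]
  note h = qfunctor_copsh_yoneda[OF X] and y = yoneda_mem_psh[OF CP \<Theta>]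
  \<comment> \<open>Off the carrier both functions have the default value of a restriction.\<close>
  have "snd ?\<sigma> \<tau> i = snd (lambda_dag Q X \<Theta>) \<tau> i" for \<tau> and i :: unit
  proof (cases "\<tau> \<in> carrier (copsh Q X)")
    case True
    then show ?thesis
      using psh_preimage_at[OF h y True] lambda_dag_at[OF \<Theta> True] qfunctor_carrier[OF h True] by simp
  next
    case False
    then show ?thesis
      by (simp add: psh_preimage_def qrel_comp_def lambda_dag_def transpose_psh_def)
  qed
  then show ?thesis by (auto simp: prod_eq_iff fun_eq_iff)
qed

lemma qfunctor_lambda_dag:
  assumes X: "qcategory Q X"
  shows "qfunctor Q (copsh Q (psh Q X)) (psh Q (copsh Q X)) (lambda_dag Q X)"
  using qfunctor_comp[OF qfunctor_yoneda[OF qcategory_copsh[OF qcategory_psh[OF X]]]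
      qfunctor_psh_preimage[OF qfunctor_copsh_yoneda[OF X]]]
  by (rule qfunctor_cong) (simp add: lambda_dag_eq_preimage[OF X])

lemmas lambda_dag_mem = qfunctor_carrier[OF qfunctor_lambda_dag]

text \<open>
  The image of \<open>\<lambda>\<^sub>X \<Theta>\<close> along the right adjoint \<open>copsh_image Q X Y f\<close> at \<open>\<tau>\<close> is its value at the
  restriction of \<open>\<tau>\<close>; on the other side the adjunction for the functor \<open>psh_image Q X Y f\<close>
  transposes the image of \<open>\<Theta>\<close>.
\<close>

lemma lambda_dag_natural:
  assumes f: "qfunctor Q X Y f" and \<Theta>: "\<Theta> \<in> carrier (copsh Q (psh Q X))"
  shows "psh_image Q (copsh Q X) (copsh Q Y) (copsh_image Q X Y f) (lambda_dag Q X \<Theta>) =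
    lambda_dag Q Y (copsh_image Q (psh Q X) (psh Q Y) (psh_image Q X Y f) \<Theta>)"
proof -
  note X = qfunctor_dom[OF f] and Y = qfunctor_cod[OF f]
  note im = qfunctor_psh_image[OF f] and cim = qfunctor_copsh_image[OF f]
  note \<lambda> = lambda_dag_mem[OF X \<Theta>] and im\<Theta> = copsh_image_mem[OF im \<Theta>]
  have "snd (psh_image Q (copsh Q X) (copsh Q Y) (copsh_image Q X Y f) (lambda_dag Q X \<Theta>)) \<tau> ()
      = snd (lambda_dag Q Y (copsh_image Q (psh Q X) (psh Q Y) (psh_image Q X Y f) \<Theta>)) \<tau> ()"
    if \<tau>: "\<tau> \<in> carrier (copsh Q Y)" for \<tau>
  proof -
    note pre = copsh_preimage_mem[OF f \<tau>]
    note h = qfunctor_carrier[OF qfunctor_copsh_yoneda[OF Y] \<tau>]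
    have "snd (psh_image Q (copsh Q X) (copsh Q Y) (copsh_image Q X Y f) (lambda_dag Q X \<Theta>)) \<tau> ()
        = snd (lambda_dag Q X \<Theta>) (copsh_preimage Q X Y f \<tau>) ()"
      using copsh_preimage_image_adjoint[OF f _ \<tau>]
      by (intro psh_image_right_adjoint[OF cim \<lambda> \<tau> pre]) simp_all
    also have "\<dots> = snd (lambda_dag Q Y (copsh_image Q (psh Q X) (psh Q Y) (psh_image Q X Y f) \<Theta>)) \<tau> ()"
      by (simp add: lambda_dag_at[OF \<Theta> pre] lambda_dag_at[OF im\<Theta> \<tau>]
          copsh_preimage_image_adjoint[OF im \<Theta> h] copsh_yoneda_natural[OF f \<tau>])
    finally show ?thesis .
  qed
  then show ?thesis
    by (intro psh_eqI[OF qcategory_copsh[OF Y] psh_image_mem[OF cim \<lambda>] lambda_dag_mem[OF Y im\<Theta>]])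
      simp_all
qed

lemma lambda_dag_yoneda:
  assumes X: "qcategory Q X" and \<tau>: "\<tau> \<in> carrier (copsh Q X)"
  shows "yoneda (copsh Q X) \<tau> = lambda_dag Q X (copsh_yoneda X \<tau>)"
proof -
  note C = qcategory_copsh[OF X] and h = qfunctor_carrier[OF qfunctor_copsh_yoneda[OF X] \<tau>]
  show ?thesis
    using lambda_dag_at[OF h] copsh_yoneda_fully_faithful[OF X _ \<tau>]
    by (intro psh_eqI[OF C yoneda_mem_psh[OF C \<tau>] lambda_dag_mem[OF X h]]) simp_all
qed

text \<open>
  The presheaf product is evaluation at representables, and there \<open>\<lambda>\<^sub>X\<close> behaves like a right adjoint:
  \<open>P(P'X)(y \<tau>, \<lambda>\<^sub>X \<Psi>) = P'(PX)(h\<^sub>X \<tau>, \<Psi>)\<close>.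
\<close>

lemma lambda_dag_psh_mult:
  assumes X: "qcategory Q X" and \<Omega>: "\<Omega> \<in> carrier (copsh Q (psh Q (psh Q X)))"
  shows "psh_mult Q (copsh Q X)
      (psh_image Q (copsh Q (psh Q X)) (psh Q (copsh Q X)) (lambda_dag Q X) (lambda_dag Q (psh Q X) \<Omega>))
    = lambda_dag Q X (copsh_image Q (psh Q (psh Q X)) (psh Q X) (psh_mult Q X) \<Omega>)"
    (is "psh_mult Q _ ?\<Sigma> = lambda_dag Q X ?\<Theta>")
proof -
  note P = qcategory_psh[OF X] and C = qcategory_copsh[OF X]
  note fl = qfunctor_lambda_dag[OF X] and s = qfunctor_psh_mult[OF X] and yC = qfunctor_yoneda[OF C]
  note \<lambda> = lambda_dag_mem[OF P \<Omega>]
  note \<Sigma> = psh_image_mem[OF fl \<lambda>] and \<Theta> = copsh_image_mem[OF s \<Omega>]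
  have "snd (psh_mult Q (copsh Q X) ?\<Sigma>) \<tau> () = snd (lambda_dag Q X ?\<Theta>) \<tau> ()"
    if \<tau>: "\<tau> \<in> carrier (copsh Q X)" for \<tau>
  proof -
    note h = qfunctor_carrier[OF qfunctor_copsh_yoneda[OF X] \<tau>]
    have "snd (psh_mult Q (copsh Q X) ?\<Sigma>) \<tau> () = snd ?\<Sigma> (yoneda (copsh Q X) \<tau>) ()"
      by (simp add: psh_mult_def psh_preimage_at[OF yC \<Sigma> \<tau>])
    also have "\<dots> = snd (lambda_dag Q (psh Q X) \<Omega>) (copsh_yoneda X \<tau>) ()"
    proof (rule psh_image_right_adjoint[OF fl \<lambda> yoneda_mem_psh[OF C \<tau>] h])
      show "chom (psh Q (copsh Q X)) (yoneda (copsh Q X) \<tau>) (lambda_dag Q X \<Psi>)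
          = chom (copsh Q (psh Q X)) (copsh_yoneda X \<tau>) \<Psi>" if \<Psi>: "\<Psi> \<in> carrier (copsh Q (psh Q X))" for \<Psi>
        by (simp add: yoneda_lemma[OF C \<tau> lambda_dag_mem[OF X \<Psi>]] lambda_dag_at[OF \<Psi> \<tau>])
    qed simp
    also have "\<dots> = snd (lambda_dag Q X ?\<Theta>) \<tau> ()"
      by (simp add: lambda_dag_at[OF \<Omega> h] lambda_dag_at[OF \<Theta> \<tau>]
          copsh_preimage_image_adjoint[OF s \<Omega> h] copsh_yoneda_psh_mult[OF X \<tau>])
    finally show ?thesis .
  qed
  then show ?thesis
    using qfunctor_carrier[OF qfunctor_psh_mult[OF C] \<Sigma>]
    by (intro psh_eqI[OF C _ lambda_dag_mem[OF X \<Theta>]]) simp_all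
qed

text \<open>Both sides evaluate at \<open>\<tau>\<close> to the pairing \<open>\<sigma> \<circ> \<tau>\<close>.\<close>

lemma lambda_dag_coyoneda:
  assumes X: "qcategory Q X" and \<sigma>: "\<sigma> \<in> carrier (psh Q X)"
  shows "psh_image Q X (copsh Q X) (coyoneda X) \<sigma> = lambda_dag Q X (coyoneda (psh Q X) \<sigma>)"
proof -
  note P = qcategory_psh[OF X] and C = qcategory_copsh[OF X] and y = qfunctor_coyoneda[OF X]
  note c = coyoneda_mem_copsh[OF P \<sigma>]
  have "snd (psh_image Q X (copsh Q X) (coyoneda X) \<sigma>) \<tau> () = snd (lambda_dag Q X (coyoneda (psh Q X) \<sigma>)) \<tau> ()"
    if \<tau>: "\<tau> \<in> carrier (copsh Q X)" for \<tau>
  proof -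
    note h = qfunctor_carrier[OF qfunctor_copsh_yoneda[OF X] \<tau>]
    have "snd (psh_image Q X (copsh Q X) (coyoneda X) \<sigma>) \<tau> () = snd (copsh_yoneda X \<tau>) () \<sigma>"
      unfolding copsh_yoneda_at[OF X \<sigma>] psh_image_def snd_conv qrel_comp_def
      using \<tau> coyoneda_lemma[OF X _ \<tau>] by (simp add: cograph_def cong: image_cong)
    then show ?thesis
      by (simp add: lambda_dag_at[OF c \<tau>] coyoneda_lemma[OF P \<sigma> h])
  qed
  then show ?thesis
    by (intro psh_eqI[OF C psh_image_mem[OF y \<sigma>] lambda_dag_mem[OF X c]]) simp_all
qed

lemma qfunctor_copsh_mult:
  "qcategory Q X \<Longrightarrow> qfunctor Q (copsh Q (copsh Q X)) (copsh Q X) (copsh_mult Q X)"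
  unfolding copsh_mult_def by (intro qfunctor_copsh_preimage qfunctor_coyoneda)

text \<open>
  The image along the multiplication becomes evaluation at \<open>coyoneda (copsh Q X) \<tau>\<close>.  Restricting
  the copresheaf that \<open>h\<close> assigns to it along \<open>\<lambda>\<^sub>X\<close> gives \<open>\<Theta> \<mapsto> \<lambda>\<^sub>X \<Theta> \<tau>\<close>, which is the
  copresheaf represented by \<open>h\<^sub>X \<tau>\<close>; the adjunction for the multiplication does the rest.
\<close>

lemma lambda_dag_copsh_mult:
  assumes X: "qcategory Q X" and \<Omega>: "\<Omega> \<in> carrier (copsh Q (copsh Q (psh Q X)))"
  shows "psh_image Q (copsh Q (copsh Q X)) (copsh Q X) (copsh_mult Q X)
      (lambda_dag Q (copsh Q X)
        (copsh_image Q (copsh Q (psh Q X)) (psh Q (copsh Q X)) (lambda_dag Q X) \<Omega>))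
    = lambda_dag Q X (copsh_mult Q (psh Q X) \<Omega>)"
    (is "psh_image Q _ _ _ (lambda_dag Q _ ?\<Theta>) = _")
proof -
  let ?C = "copsh Q X" and ?CP = "copsh Q (psh Q X)"
  note P = qcategory_psh[OF X] and C = qcategory_copsh[OF X]
  note CP = qcategory_copsh[OF P]
  note fl = qfunctor_lambda_dag[OF X] and m = qfunctor_copsh_mult[OF X]
  note \<Theta> = copsh_image_mem[OF fl \<Omega>] and m\<Omega> = copsh_mult_mem[OF P \<Omega>]
  note \<lambda> = lambda_dag_mem[OF C \<Theta>]
  have "snd (psh_image Q (copsh Q ?C) ?C (copsh_mult Q X) (lambda_dag Q ?C ?\<Theta>)) \<tau> ()
      = snd (lambda_dag Q X (copsh_mult Q (psh Q X) \<Omega>)) \<tau> ()"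
    if \<tau>: "\<tau> \<in> carrier ?C" for \<tau>
  proof -
    note h = qfunctor_carrier[OF qfunctor_copsh_yoneda[OF X] \<tau>]
    note c = coyoneda_mem_copsh[OF C \<tau>]
    note hc = qfunctor_carrier[OF qfunctor_copsh_yoneda[OF C] c]
    have "copsh_preimage Q ?CP (psh Q ?C) (lambda_dag Q X) (copsh_yoneda ?C (coyoneda ?C \<tau>))
        = coyoneda ?CP (copsh_yoneda X \<tau>)"
      using copsh_preimage_mem[OF fl hc] coyoneda_mem_copsh[OF CP h]
      by (rule copsh_eqI[OF CP])
        (simp_all add: copsh_preimage_at[OF fl hc] copsh_yoneda_coyoneda[OF C \<tau> lambda_dag_mem[OF X]]
          lambda_dag_at[OF _ \<tau>])
    moreover have "snd (psh_image Q (copsh Q ?C) ?C (copsh_mult Q X) (lambda_dag Q ?C ?\<Theta>)) \<tau> ()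
        = snd (lambda_dag Q ?C ?\<Theta>) (coyoneda ?C \<tau>) ()"
      using coyoneda_copsh_mult_adjoint[OF X \<tau>]
      by (intro psh_image_right_adjoint[OF m \<lambda> \<tau> c]) simp_all
    ultimately show ?thesis
      by (simp add: lambda_dag_at[OF \<Theta> c] copsh_preimage_image_adjoint[OF fl \<Omega> hc]
          lambda_dag_at[OF m\<Omega> \<tau>] coyoneda_copsh_mult_adjoint[OF P h \<Omega>])
  qed
  then show ?thesis
    by (intro psh_eqI[OF C psh_image_mem[OF m \<lambda>] lambda_dag_mem[OF X m\<Omega>]]) simp_all
qed

end

theorem proposition5p3:
  fixes Q :: "('o, 'm) quantaloid"
  assumes "quantaloid Q"
  shows
    "(\<forall>X :: ('a, 'o, 'm) qcategory. qcategory Q X \<longrightarrow>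
        qfunctor Q (copsh Q (psh Q X)) (psh Q (copsh Q X)) (lambda_dag Q X) \<and>
        (\<forall>\<Theta> \<in> carrier (copsh Q (psh Q X)).
           lambda_dag Q X \<Theta> =
           psh_preimage Q (copsh Q X) (copsh Q (psh Q X)) (copsh_image Q X (psh Q X) (yoneda X))
             (yoneda (copsh Q (psh Q X)) \<Theta>)))
     \<and>
     (\<forall>(X :: ('a, 'o, 'm) qcategory) (Y :: ('b, 'o, 'm) qcategory) f. qfunctor Q X Y f \<longrightarrow>
        (\<forall>\<Theta> \<in> carrier (copsh Q (psh Q X)).
           psh_image Q (copsh Q X) (copsh Q Y) (copsh_image Q X Y f) (lambda_dag Q X \<Theta>) =
           lambda_dag Q Y (copsh_image Q (psh Q X) (psh Q Y) (psh_image Q X Y f) \<Theta>)))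
     \<and>
     (\<forall>X :: ('a, 'o, 'm) qcategory. qcategory Q X \<longrightarrow>
        (\<forall>\<tau> \<in> carrier (copsh Q X).
           yoneda (copsh Q X) \<tau> =
           lambda_dag Q X (copsh_image Q X (psh Q X) (yoneda X) \<tau>)) \<and>
        (\<forall>\<Omega> \<in> carrier (copsh Q (psh Q (psh Q X))).
           psh_mult Q (copsh Q X)
             (psh_image Q (copsh Q (psh Q X)) (psh Q (copsh Q X)) (lambda_dag Q X)
               (lambda_dag Q (psh Q X) \<Omega>)) =
           lambda_dag Q X (copsh_image Q (psh Q (psh Q X)) (psh Q X) (psh_mult Q X) \<Omega>)) \<and>
        (\<forall>\<sigma> \<in> carrier (psh Q X).
           psh_image Q X (copsh Q X) (coyoneda X) \<sigma> =
           lambda_dag Q X (coyoneda (psh Q X) \<sigma>)) \<and>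
        (\<forall>\<Omega> \<in> carrier (copsh Q (copsh Q (psh Q X))).
           psh_image Q (copsh Q (copsh Q X)) (copsh Q X) (copsh_mult Q X)
             (lambda_dag Q (copsh Q X)
               (copsh_image Q (copsh Q (psh Q X)) (psh Q (copsh Q X)) (lambda_dag Q X) \<Omega>)) =
           lambda_dag Q X (copsh_mult Q (psh Q X) \<Omega>)))"
proof -
  interpret quantaloid Q by fact
  show ?thesis
    by (intro conjI allI impI ballI)
      (simp_all add: qfunctor_lambda_dag lambda_dag_eq_preimage lambda_dag_natural lambda_dag_yoneda
        lambda_dag_psh_mult lambda_dag_coyoneda lambda_dag_copsh_mult)
qed

end
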